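(* Let $(\mathfrak m, J)$ be a totally nondegenerate fundamental CR algebra of depth $\mu > 3$, let $\mathfrak g^0 = \mathfrak{aut}(\mathfrak m, J)$, and let $(\mathfrak m + \mathfrak g^0)^\infty = \mathfrak m + \mathfrak g^0 + \mathfrak g^1 + \mathfrak g^2 + \cdots$ be the full prolongation of its CR Tanaka algebra. Then $\mathfrak g^1 = \{0\}$. Consequently, the CR geometry of any totally nondegenerate CR manifold of depth $\mu>3$ (i.e. any regular CR manifold of type $(\mathfrak m, J)$ with $(\mathfrak m, J)$ a totally nondegenerate fundamental CR algebra of depth $\mu>3$) is of order $0$.
   Context: **Fundamental algebras.** A fundamental algebra of depth $\mu$ over $\mathbb K = \mathbb R$ or $\mathbb C$ is a finite-dimensional negatively graded Lie algebra $\mathfrak m = \mathfrak m^{-\mu} + \cdots + \mathfrak m^{-1}$ with $[\mathfrak m^{-i}, \mathfrak m^{-1}] = \mathfrak m^{-i-1}$ for every $i\ge 1$ (with $\mathfrak m^{-k}=0$ for $k>\mu$). $\mathfrak{aut}(\mathfrak m)$ is the Lie algebra of the group of automorphisms of the graded Lie algebra $\mathfrak m$, i.e. the algebra of degree-preserving derivations. **CR algebras.** A fundamental CR algebra $(\mathfrak m, J)$ is a real fundamental algebra with a complex structure $J:\mathfrak m^{-1}\to\mathfrak m^{-1}$ such that $[JX,JY]=[X,Y]$ for all $X,Y\in\mathfrak m^{-1}$. $\mathfrak{aut}(\mathfrak m,J)$ is the Lie algebra of the group $\operatorname{Aut}(\mathfrak m,J)$ of automorphisms of the graded Lie algebra $\mathfrak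 m$ commuting with $J$ on $\mathfrak m^{-1}$. Its CR Tanaka algebra is the non-positively graded Lie algebra $\mathfrak m+\mathfrak g^0$ with $\mathfrak g^0=\mathfrak{aut}(\mathfrak m,J)$ and $[D,X]=D(X)$ for $D\in\mathfrak g^0$, $X\in\mathfrak m$. **Prolongation.** Set $\widetilde{\mathfrak g}^{i}=\mathfrak m^{i}$ for $i\le -1$ and $\widetilde{\mathfrak g}^i=\mathfrak g^i$ for $i\ge 0$. Inductively, for $\ell\ge1$, $$\mathfrak g^\ell=\Big\{X\in\sum_{p=1}^{\mu}\operatorname{Hom}(\mathfrak m^{-p},\widetilde{\mathfrak g}^{-p+\ell}) : [X(Y),Z]+[Y,X(Z)]=X([Y,Z])\ \text{for all } Y,Z\in\mathfrak m\Big\},$$ with $[X,Y]:=X(Y)=:-[Y,X]$ for $X\in\mathfrak g^\ell$, $Y\in\mathfrak m$. There is a unique graded Lie algebra structure on $(\mathfrak m+\mathfrak g^0)^\infty=\mathfrak m+\mathfrak g^0+\sum_{\ell\ge1}\mathfrak g^\ell$ extending these brackets and the brackets of $\mathfrak m+\mathfrak g^0$. **Universal fundamental CR algebra.** Let $V$ be a finite-dimensional real vector space with complex structure $J$, and $V^{\mathbb C}=V^{10}+V^{01}$ the decomposition into the $(+i)$- and $(-i)$-eigenspaces of $J$. Let $\mathfrak U_{V^{\mathbb C}}$ be the universal fundamental algebra of depth $\mu$ generated by $V^{\mathbb C}$, i.e. the free Lie algebra on $V^{\mathbb C}$ (with $V^{\mathbb C}$ in degree $-1$) modulo all elements of degree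 less than $-\mu$. Let $\mathfrak i_{10},\mathfrak i_{01}$ be the ideals generated by $[V^{10},V^{10}]$ and $[V^{01},V^{01}]$. The universal fundamental CR algebra of depth $\mu$ generated by $(V^{\mathbb C},J)$ is $\mathfrak U_J=\mathfrak U_{V^{\mathbb C}}/(\mathfrak i_{10}+\mathfrak i_{01})$, with induced grading. For every fundamental CR algebra $(\mathfrak m,J)$ of depth $\mu$ with $\mathfrak m^{-1}=V$ there is a canonical surjective graded homomorphism $\mathfrak U_J\to\mathfrak m^{\mathbb C}$ that is the identity on $V^{\mathbb C}$. **Total nondegeneracy.** A fundamental CR algebra $(\mathfrak m,J)$ of depth $\mu\ge3$ (equivalently its CR Tanaka algebra) is totally nondegenerate if $\mathfrak m^{\mathbb C}=\mathfrak U_J/\mathfrak i^{-\mu}$ for an ideal $\mathfrak i^{-\mu}$ entirely contained in the lowest degree subspace $\mathfrak U_J^{-\mu}$. **CR manifolds.** A CR structure on a real manifold $M$ is a pair $(\mathcal D,J)$: a real distribution $\mathcal D\subset TM$ of even rank and a smooth family of complex structures $J_x:\mathcal D_x\to\mathcal D_x$ such that the $(+i)$-eigendistribution $\mathcal D^{10}\subset T^{\mathbb C}M$ is involutive. Let $\mathfrak D_{-1}$ be the class of local smooth sections of $\mathcal D$ and $\mathfrak D_{-(j+1)}=\mathfrak D_{-j}+[\mathfrak D_{-1},\mathfrak D_{-j}]$. $\mathcal D$ is regular if each $\mathfrak D_{-j}$ is the class of local sections of a constant rank distribution $\mathcal D_{-j}$ (with $\mathcal D_{-1}=\mathcal D$).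 Then $\mathfrak m^{-1}(x)=\mathcal D_x$, $\mathfrak m^{-(j+1)}(x)=\mathcal D_{-(j+1)}|_x/\mathcal D_{-j}|_x$, and $\mathfrak m(x)=\sum_j\mathfrak m^{-j}(x)$, with brackets induced by Lie brackets of vector fields and with $J_x$, is a fundamental CR algebra. $(M,\mathcal D,J)$ is regular of type $(\mathfrak m,J)$ if $\mathcal D$ is regular, every $(\mathfrak m(x),J_x)$ is isomorphic to $(\mathfrak m,J)$, and $\dim\mathfrak m=\dim M$. It is called totally nondegenerate if $(\mathfrak m,J)$ is totally nondegenerate. **Order.** If there is $k_o\ge0$ with $\mathfrak g^{k_o+1}=\{0\}$ in $(\mathfrak m+\mathfrak g^0)^\infty$ (which implies $\mathfrak g^{k_o+\ell}=\{0\}$ for all $\ell\ge1$), the CR structures of type $(\mathfrak m,J)$ are said to be of finite order, and the (smallest such) $k_o$ is called the order of their geometry. *)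

theory Defs
  imports "HOL-Analysis.Analysis"
begin

section \<open>Fundamental algebras and fundamental CR algebras\<close>

text \<open>
  A real graded Lie algebra \<open>\<mm>\<close> occupies a whole type \<open>'m\<close>; it is given by its bracket
  \<open>br\<close> and by \<open>gr\<close>, where \<open>gr k\<close> is the homogeneous part \<open>\<mm>\<^sup>-\<^sup>k\<close> of degree \<open>-k\<close>.
\<close>

definition lie_bracket_axioms :: "('m::real_vector \<Rightarrow> 'm \<Rightarrow> 'm) \<Rightarrow> bool" where
  "lie_bracket_axioms br \<longleftrightarrow>
     bilinear br \<and> (\<forall>x. br x x = 0) \<and>
     (\<forall>x y z. br x (br y z) + br y (br z x) + br z (br x y) = 0)"

definition fundamental_algebra ::
  "nat \<Rightarrow> ('m::real_vector \<Rightarrow> 'm \<Rightarrow> 'm) \<Rightarrow> (nat \<Rightarrow> 'm set) \<Rightarrow> bool" where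
  "fundamental_algebra \<mu> br gr \<longleftrightarrow>
     (\<exists>B::'m set. finite B \<and> span B = UNIV) \<and>
     lie_bracket_axioms br \<and>
     \<comment> \<open>the vector space is the direct sum of the parts of degree \<open>-\<mu>, \<dots>, -1\<close>\<close>
     (\<forall>k. subspace (gr k)) \<and>
     (\<forall>k. k = 0 \<or> k > \<mu> \<longrightarrow> gr k = {0}) \<and>
     (\<forall>x. \<exists>!f. (\<forall>k. f k \<in> gr k) \<and> x = (\<Sum>k=1..\<mu>. f k)) \<and>
     \<comment> \<open>the bracket is graded, and the algebra is generated in degree \<open>-1\<close>\<close>
     (\<forall>i j. \<forall>x\<in>gr i. \<forall>y\<in>gr j. br x y \<in> gr (i + j)) \<and>
     (\<forall>i\<ge>1. span {br x y | x y. x \<in> gr i \<and> y \<in> gr 1} = gr (i + 1)) \<and>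
     \<comment> \<open>the depth is exactly \<open>\<mu>\<close>\<close>
     1 \<le> \<mu> \<and> gr \<mu> \<noteq> {0}"

text \<open>Only the values of \<open>J\<close> on the subspace \<open>S\<close> matter.\<close>

definition complex_structure_on :: "'a::real_vector set \<Rightarrow> ('a \<Rightarrow> 'a) \<Rightarrow> bool" where
  "complex_structure_on S J \<longleftrightarrow>
     (\<forall>x\<in>S. J x \<in> S) \<and>
     (\<forall>x\<in>S. \<forall>y\<in>S. J (x + y) = J x + J y) \<and>
     (\<forall>r. \<forall>x\<in>S. J (r *\<^sub>R x) = r *\<^sub>R J x) \<and>
     (\<forall>x\<in>S. J (J x) = - x)"

definition fundamental_CR_algebra ::
  "nat \<Rightarrow> ('m::real_vector \<Rightarrow> 'm \<Rightarrow> 'm) \<Rightarrow> (nat \<Rightarrow> 'm set) \<Rightarrow> ('m \<Rightarrow> 'm) \<Rightarrow> bool" where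
  "fundamental_CR_algebra \<mu> br gr J \<longleftrightarrow>
     fundamental_algebra \<mu> br gr \<and>
     complex_structure_on (gr 1) J \<and>
     (\<forall>x\<in>gr 1. \<forall>y\<in>gr 1. br (J x) (J y) = br x y)"

text \<open>\<open>\<aa>\<uu>\<tt>(\<mm>, J)\<close>: the degree-preserving derivations that commute with \<open>J\<close> on \<open>\<mm>\<^sup>-\<^sup>1\<close>.\<close>

definition aut_CR ::
  "('m::real_vector \<Rightarrow> 'm \<Rightarrow> 'm) \<Rightarrow> (nat \<Rightarrow> 'm set) \<Rightarrow> ('m \<Rightarrow> 'm) \<Rightarrow> ('m \<Rightarrow> 'm) set" where
  "aut_CR br gr J = {D. linear D \<and>
     (\<forall>k. \<forall>x\<in>gr k. D x \<in> gr k) \<and>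
     (\<forall>x y. D (br x y) = br (D x) y + br x (D y)) \<and>
     (\<forall>x\<in>gr 1. D (J x) = J (D x))}"


section \<open>The prolongation of the CR Tanaka algebra\<close>

text \<open>
  The spaces \<open>\<gg>\<^sup>\<ell>\<close> are iterated spaces of linear maps out of \<open>\<mm>\<close>. All of them are realised inside
  one type by currying: a function \<open>A\<close> on lists is read as the pair of the element \<open>A []\<close> of \<open>\<mm>\<close>
  and of the map \<open>Y \<mapsto> pr_apply A Y\<close> from \<open>\<mm>\<close> into the same type. Elements of \<open>\<mm>\<close> have second
  component zero, and elements of \<open>\<gg>\<^sup>\<ell>\<close> with \<open>\<ell> \<ge> 0\<close> have first component zero. The vector
  space operations are pointwise, so a map \<open>F\<close> into this type is linear if and only if
  \<open>\<lambda>Y. F Y ys\<close> is linear for every list \<open>ys\<close>.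
\<close>

type_synonym 'm pr = "'m list \<Rightarrow> 'm"

definition pr_zero :: "'m::real_vector pr" where
  "pr_zero = (\<lambda>_. 0)"

definition pr_of_m :: "'m::real_vector \<Rightarrow> 'm pr" where
  "pr_of_m Y = (\<lambda>ys. if ys = [] then Y else 0)"

definition pr_of_hom :: "('m \<Rightarrow> 'm pr) \<Rightarrow> 'm::real_vector pr" where
  "pr_of_hom F = (\<lambda>ys. case ys of [] \<Rightarrow> 0 | Y # ys' \<Rightarrow> F Y ys')"

definition pr_apply :: "'m pr \<Rightarrow> 'm \<Rightarrow> 'm pr" where
  "pr_apply A Y = (\<lambda>ys. A (Y # ys))"

text \<open>
  The bracket \<open>[A, Z]\<close> with \<open>Z \<in> \<mm>\<close>: it is the bracket of \<open>\<mm>\<close> when \<open>A \<in> \<mm>\<close>, and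
  \<open>A(Z)\<close> when \<open>A \<in> \<gg>\<^sup>\<ell>\<close> with \<open>\<ell> \<ge> 0\<close>; in each case the other summand vanishes.
\<close>

definition pr_bracket ::
  "('m::real_vector \<Rightarrow> 'm \<Rightarrow> 'm) \<Rightarrow> 'm pr \<Rightarrow> 'm \<Rightarrow> 'm pr" where
  "pr_bracket br A Z = (\<lambda>ys. pr_of_m (br (A []) Z) ys + pr_apply A Z ys)"

text \<open>
  \<open>prolongation \<mu> br gr J i\<close> is the homogeneous part of degree \<open>i\<close> of \<open>(\<mm> + \<gg>\<^sup>0)\<^sup>\<infinity>\<close>:
  \<open>\<mm>\<^sup>i\<close> for \<open>i < 0\<close>, \<open>\<aa>\<uu>\<tt>(\<mm>, J)\<close> for \<open>i = 0\<close>, and for \<open>i > 0\<close> the maps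
  \<open>X : \<mm>\<^sup>-\<^sup>p \<rightarrow>\<close> (part of degree \<open>i - p\<close>) with \<open>[X(Y), Z] + [Y, X(Z)] = X([Y, Z])\<close>.
\<close>

function prolongation ::
  "nat \<Rightarrow> ('m::real_vector \<Rightarrow> 'm \<Rightarrow> 'm) \<Rightarrow> (nat \<Rightarrow> 'm set) \<Rightarrow> ('m \<Rightarrow> 'm) \<Rightarrow> int \<Rightarrow> 'm pr set"
where
  "prolongation \<mu> br gr J i =
     (if i < 0 then pr_of_m ` gr (nat (- i))
      else if i = 0 then {pr_of_hom (\<lambda>Y. pr_of_m (D Y)) | D. D \<in> aut_CR br gr J}
      else {X. X [] = 0 \<and>
               (\<forall>ys. linear (\<lambda>Y. pr_apply X Y ys)) \<and>
               (\<forall>p\<in>{1..\<mu>}. \<forall>Y\<in>gr p. pr_apply X Y \<in> prolongation \<mu> br gr J (i - int p)) \<and>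
               (\<forall>Y Z ys. pr_bracket br (pr_apply X Y) Z ys - pr_bracket br (pr_apply X Z) Y ys
                         = pr_apply X (br Y Z) ys)})"
  by auto
termination
  by (relation "Wellfounded.measure (\<lambda>(\<mu>, br, gr, J, i). nat i)") auto

declare prolongation.simps [simp del]

text \<open>The order of the geometry of the CR structures of type \<open>(\<mm>, J)\<close>.\<close>

definition finite_order ::
  "nat \<Rightarrow> ('m::real_vector \<Rightarrow> 'm \<Rightarrow> 'm) \<Rightarrow> (nat \<Rightarrow> 'm set) \<Rightarrow> ('m \<Rightarrow> 'm) \<Rightarrow> bool" where
  "finite_order \<mu> br gr J \<longleftrightarrow> (\<exists>k::nat. prolongation \<mu> br gr J (int k + 1) = {pr_zero})"

definition geometry_order ::
  "nat \<Rightarrow> ('m::real_vector \<Rightarrow> 'm \<Rightarrow> 'm) \<Rightarrow> (nat \<Rightarrow> 'm set) \<Rightarrow> ('m \<Rightarrow> 'm) \<Rightarrow> nat" where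
  "geometry_order \<mu> br gr J = (LEAST k. prolongation \<mu> br gr J (int k + 1) = {pr_zero})"


section \<open>Graded Lie algebras on carriers: isomorphisms, ideals and quotients\<close>

text \<open>
  Quotients by ideals that depend on parameters need explicit carriers. As before,
  \<open>pc L k\<close> is the homogeneous part of degree \<open>-k\<close>.
\<close>

record ('k, 'a) glie =
  car :: "'a set"
  add :: "'a \<Rightarrow> 'a \<Rightarrow> 'a"
  zer :: "'a"
  smul :: "'k \<Rightarrow> 'a \<Rightarrow> 'a"
  brk :: "'a \<Rightarrow> 'a \<Rightarrow> 'a"
  pc :: "nat \<Rightarrow> 'a set"

definition glie_iso :: "('a \<Rightarrow> 'b) \<Rightarrow> ('k, 'a) glie \<Rightarrow> ('k, 'b) glie \<Rightarrow> bool" where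
  "glie_iso \<phi> L L' \<longleftrightarrow>
     bij_betw \<phi> (car L) (car L') \<and>
     (\<forall>x\<in>car L. \<forall>y\<in>car L. \<phi> (add L x y) = add L' (\<phi> x) (\<phi> y)) \<and>
     (\<forall>c. \<forall>x\<in>car L. \<phi> (smul L c x) = smul L' c (\<phi> x)) \<and>
     (\<forall>x\<in>car L. \<forall>y\<in>car L. \<phi> (brk L x y) = brk L' (\<phi> x) (\<phi> y)) \<and>
     (\<forall>k. \<phi> ` pc L k = pc L' k)"

definition lie_ideal :: "('k, 'a) glie \<Rightarrow> 'a set \<Rightarrow> bool" where
  "lie_ideal L I \<longleftrightarrow>
     I \<subseteq> car L \<and> zer L \<in> I \<and>
     (\<forall>x\<in>I. \<forall>y\<in>I. add L x y \<in> I) \<and>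
     (\<forall>c. \<forall>x\<in>I. smul L c x \<in> I) \<and>
     (\<forall>x\<in>car L. \<forall>y\<in>I. brk L x y \<in> I)"

definition ideal_gen :: "('k, 'a) glie \<Rightarrow> 'a set \<Rightarrow> 'a set" where
  "ideal_gen L S = \<Inter>{I. lie_ideal L I \<and> S \<subseteq> I}"

definition ideal_sum :: "('k, 'a) glie \<Rightarrow> 'a set \<Rightarrow> 'a set \<Rightarrow> 'a set" where
  "ideal_sum L I I' = {add L x y | x y. x \<in> I \<and> y \<in> I'}"

definition lcoset :: "('k, 'a) glie \<Rightarrow> 'a set \<Rightarrow> 'a \<Rightarrow> 'a set" where
  "lcoset L I x = {add L x i | i. i \<in> I}"

definition quot :: "('k, 'a) glie \<Rightarrow> 'a set \<Rightarrow> ('k, 'a set) glie" where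
  "quot L I =
     \<lparr> car = lcoset L I ` car L,
       add = (\<lambda>A B. {add L a b | a b. a \<in> A \<and> b \<in> B}),
       zer = I,
       smul = (\<lambda>c A. {add L (smul L c a) i | a i. a \<in> A \<and> i \<in> I}),
       brk = (\<lambda>A B. {add L (brk L a b) i | a b i. a \<in> A \<and> b \<in> B \<and> i \<in> I}),
       pc = (\<lambda>k. lcoset L I ` pc L k) \<rparr>"

definition glie_of ::
  "('m::real_vector \<Rightarrow> 'm \<Rightarrow> 'm) \<Rightarrow> (nat \<Rightarrow> 'm set) \<Rightarrow> (real, 'm) glie" where
  "glie_of br gr =
     \<lparr> car = UNIV, add = (+), zer = 0, smul = (*\<^sub>R), brk = br, pc = gr \<rparr>"

text \<open>In complexifications, the pair \<open>(x, y)\<close> stands for \<open>x + \<i>y\<close>.\<close>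

definition cscale :: "complex \<Rightarrow> 'm::real_vector \<times> 'm \<Rightarrow> 'm \<times> 'm" where
  "cscale c = (\<lambda>(x, y). (Re c *\<^sub>R x - Im c *\<^sub>R y, Re c *\<^sub>R y + Im c *\<^sub>R x))"

definition complexification ::
  "('m::real_vector \<Rightarrow> 'm \<Rightarrow> 'm) \<Rightarrow> (nat \<Rightarrow> 'm set) \<Rightarrow> (complex, 'm \<times> 'm) glie" where
  "complexification br gr =
     \<lparr> car = UNIV, add = (+), zer = 0, smul = cscale,
       brk = (\<lambda>(x, y) (x', y'). (br x x' - br y y', br x y' + br y x')),
       pc = (\<lambda>k. gr k \<times> gr k) \<rparr>"


section \<open>Free Lie algebras and universal fundamental CR algebras\<close>

datatype (dead 'k, gens: 'v) lterm =
    TZero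
  | TGen 'v
  | TAdd "('k, 'v) lterm" "('k, 'v) lterm"
  | TScale 'k "('k, 'v) lterm"
  | TBr "('k, 'v) lterm" "('k, 'v) lterm"

text \<open>
  The congruence generated by the axioms of a Lie algebra and by the linearity of
  \<open>TGen\<close> on the vector space \<open>W\<close>, whose scalar multiplication is \<open>sc\<close>.
\<close>

inductive lie_eq ::
  "('k::field \<Rightarrow> 'v::ab_group_add \<Rightarrow> 'v) \<Rightarrow> 'v set \<Rightarrow> ('k, 'v) lterm \<Rightarrow> ('k, 'v) lterm \<Rightarrow> bool"
  for sc W
where
  refl: "lie_eq sc W s s"
| sym: "lie_eq sc W s t \<Longrightarrow> lie_eq sc W t s"
| trans: "lie_eq sc W s t \<Longrightarrow> lie_eq sc W t u \<Longrightarrow> lie_eq sc W s u"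
| cong_add: "lie_eq sc W s s' \<Longrightarrow> lie_eq sc W t t' \<Longrightarrow> lie_eq sc W (TAdd s t) (TAdd s' t')"
| cong_scale: "lie_eq sc W s s' \<Longrightarrow> lie_eq sc W (TScale c s) (TScale c s')"
| cong_br: "lie_eq sc W s s' \<Longrightarrow> lie_eq sc W t t' \<Longrightarrow> lie_eq sc W (TBr s t) (TBr s' t')"
| add_assoc: "lie_eq sc W (TAdd (TAdd s t) u) (TAdd s (TAdd t u))"
| add_commute: "lie_eq sc W (TAdd s t) (TAdd t s)"
| add_zero: "lie_eq sc W (TAdd TZero s) s"
| add_minus: "lie_eq sc W (TAdd s (TScale (- 1) s)) TZero"
| scale_one: "lie_eq sc W (TScale 1 s) s"
| scale_scale: "lie_eq sc W (TScale c (TScale d s)) (TScale (c * d) s)"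
| scale_add_right: "lie_eq sc W (TScale c (TAdd s t)) (TAdd (TScale c s) (TScale c t))"
| scale_add_left: "lie_eq sc W (TScale (c + d) s) (TAdd (TScale c s) (TScale d s))"
| br_add_left: "lie_eq sc W (TBr (TAdd s t) u) (TAdd (TBr s u) (TBr t u))"
| br_add_right: "lie_eq sc W (TBr u (TAdd s t)) (TAdd (TBr u s) (TBr u t))"
| br_scale_left: "lie_eq sc W (TBr (TScale c s) t) (TScale c (TBr s t))"
| br_scale_right: "lie_eq sc W (TBr s (TScale c t)) (TScale c (TBr s t))"
| br_self: "lie_eq sc W (TBr s s) TZero"
| jacobi:
    "lie_eq sc W (TAdd (TBr s (TBr t u)) (TAdd (TBr t (TBr u s)) (TBr u (TBr s t)))) TZero"
| gen_add:
    "v \<in> W \<Longrightarrow> w \<in> W \<Longrightarrow> lie_eq sc W (TGen (v + w)) (TAdd (TGen v) (TGen w))"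
| gen_scale: "v \<in> W \<Longrightarrow> lie_eq sc W (TGen (sc c v)) (TScale c (TGen v))"

definition lterms :: "'v set \<Rightarrow> ('k, 'v) lterm set" where
  "lterms W = {t. gens t \<subseteq> W}"

definition lclass ::
  "('k::field \<Rightarrow> 'v::ab_group_add \<Rightarrow> 'v) \<Rightarrow> 'v set \<Rightarrow> ('k, 'v) lterm \<Rightarrow> ('k, 'v) lterm set" where
  "lclass sc W t = {s \<in> lterms W. lie_eq sc W t s}"

inductive homogeneous :: "nat \<Rightarrow> ('k, 'v) lterm \<Rightarrow> bool" where
  "homogeneous k TZero"
| "homogeneous 1 (TGen v)"
| "homogeneous k s \<Longrightarrow> homogeneous k t \<Longrightarrow> homogeneous k (TAdd s t)"
| "homogeneous k s \<Longrightarrow> homogeneous k (TScale c s)"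
| "homogeneous j s \<Longrightarrow> homogeneous k t \<Longrightarrow> homogeneous (j + k) (TBr s t)"

text \<open>The free Lie algebra on \<open>W\<close>, graded with \<open>W\<close> in degree \<open>-1\<close>.\<close>

definition free_lie ::
  "('k::field \<Rightarrow> 'v::ab_group_add \<Rightarrow> 'v) \<Rightarrow> 'v set \<Rightarrow> ('k, ('k, 'v) lterm set) glie" where
  "free_lie sc W =
     \<lparr> car = lclass sc W ` lterms W,
       add = (\<lambda>A B. \<Union>s\<in>A. \<Union>t\<in>B. lclass sc W (TAdd s t)),
       zer = lclass sc W TZero,
       smul = (\<lambda>c A. \<Union>s\<in>A. lclass sc W (TScale c s)),
       brk = (\<lambda>A B. \<Union>s\<in>A. \<Union>t\<in>B. lclass sc W (TBr s t)),
       pc = (\<lambda>k. lclass sc W ` {t \<in> lterms W. homogeneous k t}) \<rparr>"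

definition truncation_ideal ::
  "nat \<Rightarrow> ('k::field \<Rightarrow> 'v::ab_group_add \<Rightarrow> 'v) \<Rightarrow> 'v set \<Rightarrow> ('k, 'v) lterm set set" where
  "truncation_ideal \<mu> sc W = ideal_gen (free_lie sc W) (\<Union>k\<in>{\<mu><..}. pc (free_lie sc W) k)"

definition universal_fundamental ::
  "nat \<Rightarrow> ('k::field \<Rightarrow> 'v::ab_group_add \<Rightarrow> 'v) \<Rightarrow> 'v set \<Rightarrow> ('k, ('k, 'v) lterm set set) glie"
where
  "universal_fundamental \<mu> sc W = quot (free_lie sc W) (truncation_ideal \<mu> sc W)"

text \<open>The image of \<open>w \<in> W\<close> in the universal fundamental algebra.\<close>

definition universal_gen ::
  "nat \<Rightarrow> ('k::field \<Rightarrow> 'v::ab_group_add \<Rightarrow> 'v) \<Rightarrow> 'v set \<Rightarrow> 'v \<Rightarrow> ('k, 'v) lterm set set" where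
  "universal_gen \<mu> sc W w =
     lcoset (free_lie sc W) (truncation_ideal \<mu> sc W) (lclass sc W (TGen w))"

definition V10 :: "'m::real_vector set \<Rightarrow> ('m \<Rightarrow> 'm) \<Rightarrow> ('m \<times> 'm) set" where
  "V10 V J = {(x, y). x \<in> V \<and> y \<in> V \<and> (J x, J y) = cscale \<i> (x, y)}"

definition V01 :: "'m::real_vector set \<Rightarrow> ('m \<Rightarrow> 'm) \<Rightarrow> ('m \<times> 'm) set" where
  "V01 V J = {(x, y). x \<in> V \<and> y \<in> V \<and> (J x, J y) = cscale (- \<i>) (x, y)}"

text \<open>The ideal generated by \<open>[E, E]\<close>, for \<open>E \<subseteq> V\<^sup>\<complex>\<close>.\<close>

definition bracket_ideal ::
  "nat \<Rightarrow> 'm::real_vector set \<Rightarrow> ('m \<times> 'm) set \<Rightarrow> (complex, 'm \<times> 'm) lterm set set set" where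
  "bracket_ideal \<mu> V E =
     (let U = universal_fundamental \<mu> cscale (V \<times> V);
          g = universal_gen \<mu> cscale (V \<times> V)
      in ideal_gen U {brk U (g v) (g w) | v w. v \<in> E \<and> w \<in> E})"

definition CR_ideal ::
  "nat \<Rightarrow> 'm::real_vector set \<Rightarrow> ('m \<Rightarrow> 'm) \<Rightarrow> (complex, 'm \<times> 'm) lterm set set set" where
  "CR_ideal \<mu> V J =
     ideal_sum (universal_fundamental \<mu> cscale (V \<times> V))
       (bracket_ideal \<mu> V (V10 V J)) (bracket_ideal \<mu> V (V01 V J))"

definition universal_CR ::
  "nat \<Rightarrow> 'm::real_vector set \<Rightarrow> ('m \<Rightarrow> 'm) \<Rightarrow>
     (complex, (complex, 'm \<times> 'm) lterm set set set) glie" where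
  "universal_CR \<mu> V J = quot (universal_fundamental \<mu> cscale (V \<times> V)) (CR_ideal \<mu> V J)"

definition universal_CR_gen ::
  "nat \<Rightarrow> 'm::real_vector set \<Rightarrow> ('m \<Rightarrow> 'm) \<Rightarrow> 'm \<times> 'm \<Rightarrow>
     (complex, 'm \<times> 'm) lterm set set set" where
  "universal_CR_gen \<mu> V J v =
     lcoset (universal_fundamental \<mu> cscale (V \<times> V)) (CR_ideal \<mu> V J)
       (universal_gen \<mu> cscale (V \<times> V) v)"

text \<open>
  The equality of \<open>\<mm>\<^sup>\<complex>\<close> with a quotient of \<open>\<UU>\<^sub>J\<close> is the canonical one, i.e. the
  identity on \<open>V\<^sup>\<complex>\<close>, where \<open>V = \<mm>\<^sup>-\<^sup>1\<close>.
\<close>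

definition totally_nondegenerate ::
  "nat \<Rightarrow> ('m::real_vector \<Rightarrow> 'm \<Rightarrow> 'm) \<Rightarrow> (nat \<Rightarrow> 'm set) \<Rightarrow> ('m \<Rightarrow> 'm) \<Rightarrow> bool" where
  "totally_nondegenerate \<mu> br gr J \<longleftrightarrow>
     3 \<le> \<mu> \<and>
     (\<exists>I \<phi>. lie_ideal (universal_CR \<mu> (gr 1) J) I \<and>
            I \<subseteq> pc (universal_CR \<mu> (gr 1) J) \<mu> \<and>
            glie_iso \<phi> (quot (universal_CR \<mu> (gr 1) J) I) (complexification br gr) \<and>
            (\<forall>v\<in>gr 1 \<times> gr 1.
               \<phi> (lcoset (universal_CR \<mu> (gr 1) J) I (universal_CR_gen \<mu> (gr 1) J v)) = v))"


section \<open>CR manifolds\<close>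

text \<open>\<open>C\<^sup>k\<close> and \<open>C\<^sup>\<infinity>\<close> maps; used for open sets only.\<close>

primrec Ck_on :: "nat \<Rightarrow> 'a::real_normed_vector set \<Rightarrow> ('a \<Rightarrow> 'b::real_normed_vector) \<Rightarrow> bool" where
  "Ck_on 0 S f \<longleftrightarrow> continuous_on S f"
| "Ck_on (Suc k) S f \<longleftrightarrow>
     f differentiable_on S \<and> (\<forall>v. Ck_on k S (\<lambda>x. frechet_derivative f (at x) v))"

definition smooth_on :: "'a::real_normed_vector set \<Rightarrow> ('a \<Rightarrow> 'b::real_normed_vector) \<Rightarrow> bool" where
  "smooth_on S f \<longleftrightarrow> (\<forall>k. Ck_on k S f)"

text \<open>
  A chart \<open>c = (U, \<phi>)\<close> consists of its domain and of its coordinate map. The manifold is the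
  whole type \<open>'p\<close>; its dimension is \<open>DIM('e)\<close>.
\<close>

type_synonym ('p, 'e) chart = "'p set \<times> ('p \<Rightarrow> 'e)"

definition chart_inv :: "('p, 'e) chart \<Rightarrow> 'e \<Rightarrow> 'p" where
  "chart_inv c = inv_into (fst c) (snd c)"

definition smooth_atlas ::
  "('p::{t2_space,second_countable_topology}, 'e::euclidean_space) chart set \<Rightarrow> bool" where
  "smooth_atlas A \<longleftrightarrow>
     (\<Union>c\<in>A. fst c) = UNIV \<and>
     (\<forall>c\<in>A. open (fst c) \<and> open (snd c ` fst c) \<and>
            homeomorphism (fst c) (snd c ` fst c) (snd c) (chart_inv c)) \<and>
     (\<forall>c\<in>A. \<forall>c'\<in>A. smooth_on (snd c ` (fst c \<inter> fst c')) (snd c' \<circ> chart_inv c))"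

text \<open>
  Tensorial objects are given by their coordinate expressions: \<open>X c x\<close> is the expression in
  the chart \<open>c\<close>, at a point \<open>x\<close> of its domain, of a vector field \<open>X\<close>, and similarly \<open>D c x\<close>
  for a distribution \<open>D\<close> and \<open>J c x\<close> for a field of endomorphisms. These expressions are
  related by the derivatives of the coordinate changes.
\<close>

definition transition :: "('p, 'e::euclidean_space) chart \<Rightarrow> ('p, 'e) chart \<Rightarrow> 'p \<Rightarrow> 'e \<Rightarrow> 'e" where
  "transition c c' x = frechet_derivative (snd c' \<circ> chart_inv c) (at (snd c x))"

type_synonym ('p, 'e) vfield = "('p, 'e) chart \<Rightarrow> 'p \<Rightarrow> 'e"
type_synonym ('p, 'e) dist = "('p, 'e) chart \<Rightarrow> 'p \<Rightarrow> 'e set"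

definition vector_field ::
  "('p::{t2_space,second_countable_topology}, 'e::euclidean_space) chart set \<Rightarrow> 'p set \<Rightarrow>
     ('p, 'e) vfield \<Rightarrow> bool" where
  "vector_field A U X \<longleftrightarrow>
     open U \<and>
     (\<forall>c\<in>A. smooth_on (snd c ` (fst c \<inter> U)) (X c \<circ> chart_inv c)) \<and>
     (\<forall>c\<in>A. \<forall>c'\<in>A. \<forall>x\<in>U \<inter> fst c \<inter> fst c'. X c' x = transition c c' x (X c x))"

definition vf_bracket ::
  "('p, 'e::euclidean_space) vfield \<Rightarrow> ('p, 'e) vfield \<Rightarrow> ('p, 'e) vfield" where
  "vf_bracket X Y = (\<lambda>c x.
     frechet_derivative (Y c \<circ> chart_inv c) (at (snd c x)) (X c x)
     - frechet_derivative (X c \<circ> chart_inv c) (at (snd c x)) (Y c x))"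

text \<open>Local smooth sections \<open>(U, X)\<close> of \<open>D\<close>; the values of \<open>X\<close> outside \<open>U\<close> are irrelevant.\<close>

definition sections ::
  "('p::{t2_space,second_countable_topology}, 'e::euclidean_space) chart set \<Rightarrow> ('p, 'e) dist \<Rightarrow>
     ('p set \<times> ('p, 'e) vfield) set" where
  "sections A D = {(U, X). vector_field A U X \<and> (\<forall>c\<in>A. \<forall>x\<in>U \<inter> fst c. X c x \<in> D c x)}"

definition distribution ::
  "('p::{t2_space,second_countable_topology}, 'e::euclidean_space) chart set \<Rightarrow> nat \<Rightarrow>
     ('p, 'e) dist \<Rightarrow> bool" where
  "distribution A r D \<longleftrightarrow>
     (\<forall>c\<in>A. \<forall>x\<in>fst c. subspace (D c x) \<and> dim (D c x) = r) \<and>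
     (\<forall>c\<in>A. \<forall>c'\<in>A. \<forall>x\<in>fst c \<inter> fst c'. D c' x = transition c c' x ` D c x) \<and>
     (\<forall>x. \<exists>U X. x \<in> U \<and> (\<forall>i<r. vector_field A U (X i)) \<and> open U \<and>
        (\<forall>c\<in>A. \<forall>y\<in>U \<inter> fst c. D c y = span ((\<lambda>i. X i c y) ` {..<r})))"

definition complex_structure_field ::
  "('p::{t2_space,second_countable_topology}, 'e::euclidean_space) chart set \<Rightarrow> ('p, 'e) dist \<Rightarrow>
     (('p, 'e) chart \<Rightarrow> 'p \<Rightarrow> 'e \<Rightarrow> 'e) \<Rightarrow> bool" where
  "complex_structure_field A D J \<longleftrightarrow>
     (\<forall>c\<in>A. \<forall>x\<in>fst c. complex_structure_on (D c x) (J c x)) \<and>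
     (\<forall>c\<in>A. \<forall>c'\<in>A. \<forall>x\<in>fst c \<inter> fst c'. \<forall>v\<in>D c x.
        J c' x (transition c c' x v) = transition c c' x (J c x v)) \<and>
     (\<forall>(U, X)\<in>sections A D. (U, \<lambda>c x. J c x (X c x)) \<in> sections A D)"

text \<open>
  Local sections \<open>X + \<i>Y\<close> of \<open>\<D>\<^sup>1\<^sup>0\<close>, given by their real and imaginary parts; the eigenvector
  equation \<open>J (X + \<i>Y) = \<i> (X + \<i>Y)\<close> reads \<open>J X = - Y\<close>, \<open>J Y = X\<close>.
\<close>

definition sections10 ::
  "('p::{t2_space,second_countable_topology}, 'e::euclidean_space) chart set \<Rightarrow> ('p, 'e) dist \<Rightarrow>
     (('p, 'e) chart \<Rightarrow> 'p \<Rightarrow> 'e \<Rightarrow> 'e) \<Rightarrow> ('p set \<times> ('p, 'e) vfield \<times> ('p, 'e) vfield) set" where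
  "sections10 A D J = {(U, X, Y).
     (U, X) \<in> sections A D \<and> (U, Y) \<in> sections A D \<and>
     (\<forall>c\<in>A. \<forall>x\<in>U \<inter> fst c. J c x (X c x) = - Y c x \<and> J c x (Y c x) = X c x)}"

definition CR_manifold ::
  "('p::{t2_space,second_countable_topology}, 'e::euclidean_space) chart set \<Rightarrow> ('p, 'e) dist \<Rightarrow>
     (('p, 'e) chart \<Rightarrow> 'p \<Rightarrow> 'e \<Rightarrow> 'e) \<Rightarrow> bool" where
  "CR_manifold A D J \<longleftrightarrow>
     smooth_atlas A \<and>
     (\<exists>r. even r \<and> distribution A r D) \<and>
     complex_structure_field A D J \<and>
     \<comment> \<open>involutivity: \<open>[X + \<i>Y, X' + \<i>Y'] = ([X, X'] - [Y, Y']) + \<i> ([X, Y'] + [Y, X'])\<close>\<close>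
     (\<forall>U X Y X' Y'. (U, X, Y) \<in> sections10 A D J \<longrightarrow> (U, X', Y') \<in> sections10 A D J \<longrightarrow>
        (U, \<lambda>c x. vf_bracket X X' c x - vf_bracket Y Y' c x,
            \<lambda>c x. vf_bracket X Y' c x + vf_bracket Y X' c x) \<in> sections10 A D J)"

text \<open>
  \<open>derived A D j\<close> is the class \<open>\<DD>\<^sub>-\<^sub>j\<close>, with the convention that \<open>\<DD>\<^sub>0\<close> consists of the zero fields.
  As usual for sheaves, an element of a sum of brackets is a field which is locally a finite sum
  of brackets.
\<close>

fun derived ::
  "('p::{t2_space,second_countable_topology}, 'e::euclidean_space) chart set \<Rightarrow> ('p, 'e) dist \<Rightarrow>
     nat \<Rightarrow> ('p set \<times> ('p, 'e) vfield) set" where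
  "derived A D 0 = sections A (\<lambda>_ _. {0})"
| "derived A D (Suc 0) = sections A D"
| "derived A D (Suc (Suc j)) = {(U, X). vector_field A U X \<and>
     (\<forall>x\<in>U. \<exists>W Y (n::nat) P Q. x \<in> W \<and> W \<subseteq> U \<and> open W \<and>
        (W, Y) \<in> derived A D (Suc j) \<and>
        (\<forall>i<n. (W, P i) \<in> sections A D \<and> (W, Q i) \<in> derived A D (Suc j)) \<and>
        (\<forall>c\<in>A. \<forall>y\<in>W \<inter> fst c. X c y = Y c y + (\<Sum>i<n. vf_bracket (P i) (Q i) c y)))}"

text \<open>The distribution \<open>\<D>\<^sub>-\<^sub>j\<close> of the values of the fields in \<open>\<DD>\<^sub>-\<^sub>j\<close>.\<close>

definition derived_dist ::
  "('p::{t2_space,second_countable_topology}, 'e::euclidean_space) chart set \<Rightarrow> ('p, 'e) dist \<Rightarrow>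
     nat \<Rightarrow> ('p, 'e) dist" where
  "derived_dist A D j c x = {X c x | U X. (U, X) \<in> derived A D j \<and> x \<in> U}"

definition regular_distribution ::
  "('p::{t2_space,second_countable_topology}, 'e::euclidean_space) chart set \<Rightarrow> ('p, 'e) dist \<Rightarrow>
     bool" where
  "regular_distribution A D \<longleftrightarrow>
     (\<forall>j\<ge>1. (\<exists>r. distribution A r (derived_dist A D j)) \<and>
            derived A D j = sections A (derived_dist A D j))"

text \<open>
  The symbol algebra \<open>\<mm>(x)\<close>, in the coordinates of the chart \<open>c\<close>. An element is the sequence
  \<open>a\<close> of its homogeneous components \<open>a j \<in> \<D>\<^sub>-\<^sub>j|\<^sub>x / \<D>\<^sub>-\<^sub>j\<^sub>+\<^sub>1|\<^sub>x\<close> for \<open>j \<ge> 1\<close>, which are cosets (and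
  \<open>a 0 = {0}\<close>). The component of degree \<open>-k\<close> of a bracket is the sum over \<open>i\<close> of the cosets of
  \<open>[X, Y](x)\<close>, where \<open>X\<close> in \<open>\<DD>\<^sub>-\<^sub>i\<close> and \<open>Y\<close> in \<open>\<DD>\<^sub>-\<^sub>k\<^sub>+\<^sub>i\<close> extend the given components.
\<close>

definition symbol_algebra ::
  "('p::{t2_space,second_countable_topology}, 'e::euclidean_space) chart set \<Rightarrow> ('p, 'e) dist \<Rightarrow>
     ('p, 'e) chart \<Rightarrow> 'p \<Rightarrow> (real, nat \<Rightarrow> 'e set) glie" where
  "symbol_algebra A D c x =
     (let E = (\<lambda>j. derived_dist A D j c x);
          C = {a. a 0 = {0} \<and> (\<forall>j. \<exists>v\<in>E (Suc j). a (Suc j) = (\<lambda>w. v + w) ` E j)}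
      in \<lparr> car = C,
           add = (\<lambda>a b j. {v + w | v w. v \<in> a j \<and> w \<in> b j}),
           zer = (\<lambda>j. E (j - 1)),
           smul = (\<lambda>r a j. {r *\<^sub>R v + w | v w. v \<in> a j \<and> w \<in> E (j - 1)}),
           brk = (\<lambda>a b k. {(\<Sum>i=1..<k. z i) + w | z w. w \<in> E (k - 1) \<and>
                    (\<forall>i\<in>{1..<k}. \<exists>U X Y. x \<in> U \<and>
                       (U, X) \<in> derived A D i \<and> X c x \<in> a i \<and>
                       (U, Y) \<in> derived A D (k - i) \<and> Y c x \<in> b (k - i) \<and>
                       z i = vf_bracket X Y c x)}),
           pc = (\<lambda>k. {a\<in>C. \<forall>j. j \<noteq> k \<longrightarrow> a j = E (j - 1)}) \<rparr>)"

text \<open>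
  \<open>(M, \<D>, J)\<close> is regular of type \<open>(\<mm>, j)\<close>. The component of degree \<open>-1\<close> of an element of \<open>\<mm>(x)\<close> is
  a singleton \<open>{v}\<close> with \<open>v \<in> \<D>\<^sub>x\<close>, so that \<open>J\<^sub>x\<close> acts on it by taking images.
\<close>

definition regular_of_type ::
  "('p::{t2_space,second_countable_topology}, 'e::euclidean_space) chart set \<Rightarrow> ('p, 'e) dist \<Rightarrow>
     (('p, 'e) chart \<Rightarrow> 'p \<Rightarrow> 'e \<Rightarrow> 'e) \<Rightarrow>
     ('m::real_vector \<Rightarrow> 'm \<Rightarrow> 'm) \<Rightarrow> (nat \<Rightarrow> 'm set) \<Rightarrow> ('m \<Rightarrow> 'm) \<Rightarrow> bool" where
  "regular_of_type A D J br gr j \<longleftrightarrow>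
     regular_distribution A D \<and>
     (\<forall>c\<in>A. \<forall>x\<in>fst c. \<exists>\<phi>.
        glie_iso \<phi> (symbol_algebra A D c x) (glie_of br gr) \<and>
        (\<forall>a\<in>pc (symbol_algebra A D c x) 1. \<phi> (a(1 := J c x ` a 1)) = j (\<phi> a))) \<and>
     dim (UNIV :: 'm set) = DIM('e)"

end

theory Submission
  imports Defs
begin

text \<open>
  Why \<open>\<gg>\<^sup>1 = 0\<close>. Complexify and let \<open>W\<^sub>0\<close>, \<open>W\<^sub>1\<close> be the eigenspaces of \<open>J\<close> in \<open>V\<^sup>\<complex>\<close>, where
  \<open>V = \<mm>\<^sup>-\<^sup>1\<close>. An element of \<open>\<gg>\<^sup>1\<close> assigns to \<open>z \<in> V\<^sup>\<complex>\<close> a derivation \<open>P z\<close> of degree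
  zero that preserves \<open>W\<^sub>0\<close> and \<open>W\<^sub>1\<close>, and it maps \<open>\<mm>\<^sup>-\<^sup>k\<close> to \<open>\<mm>\<^sup>-\<^sup>k\<^sup>+\<^sup>1\<close>, for \<open>k \<ge> 2\<close>, by a map
  \<open>X\<close> with \<open>X [z, u] = P z u + [z, X u]\<close> for \<open>u\<close> of degree at most \<open>-2\<close>. A bracket of \<open>\<mu> + 1\<close> elements of \<open>V\<^sup>\<complex>\<close> vanishes in \<open>\<mm>\<^sup>\<complex>\<close>. Applying
  \<open>X\<close> twice to it gives a relation in degree \<open>-(\<mu> - 1)\<close>, but total nondegeneracy says that this part
  of \<open>\<mm>\<^sup>\<complex>\<close> agrees with that of the universal algebra, where there are few relations.

  Two brackets suffice. For \<open>w \<in> W\<^sub>0\<close> and \<open>v \<in> W\<^sub>1\<close>, the bracket \<open>[w, [w, \<dots>, [w, v]]]\<close> yields that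
  \<open>P w w = l w\<close> for a scalar \<open>l\<close>, and that \<open>(2 B + (\<mu> - 1) l) (2 B + (\<mu> - 2) l) = 0\<close> for
  \<open>B = P w\<close> on \<open>W\<^sub>1\<close> (lemma \<open>X_squared_pure_string\<close>). The bracket \<open>[w, [w, Z]]\<close> with
  \<open>Z = [v, [v, \<dots>, [v, w']]]\<close> yields \<open>P (P w w) Z + 2 P w (P w Z) = 0\<close> up to brackets of other types
  (lemma \<open>X_squared_mixed_string\<close>). On an eigenvector \<open>v\<close> of \<open>B\<close>, and with \<open>w' = w\<close>, the eigenvalues
  allowed by the two relations are incompatible for \<open>\<mu> > 3\<close> unless \<open>l = 0\<close> (lemma \<open>no_common_root\<close>).
  Then \<open>P w\<close> vanishes on \<open>W\<^sub>0\<close> by polarization, and the two relations force it to vanish on \<open>W\<^sub>1\<close>.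
  Interchanging \<open>W\<^sub>0\<close> and \<open>W\<^sub>1\<close> gives \<open>P = 0\<close> on \<open>V\<^sup>\<complex>\<close>, and everything else vanishes because \<open>\<mm>\<close> is
  generated by \<open>V\<close>.

  The brackets whose independence in the universal algebra is used have a single entry from one of
  the eigenspaces. The independence is detected by homomorphisms from \<open>\<mm>\<^sup>\<complex>\<close> to the filiform Lie
  algebra of depth \<open>\<mu> - 1\<close> (lemma \<open>filiform_quotient\<close>), which exist by the universal property of
  \<open>\<mm>\<^sup>\<complex>\<close> with respect to algebras of depth less than \<open>\<mu>\<close> (lemma \<open>universal_property\<close>).

  The order of the geometry is the least \<open>k\<close> with \<open>\<gg>\<^sup>k\<^sup>+\<^sup>1 = 0\<close>, so it is \<open>0\<close>.
\<close>

section \<open>Lie algebras on carriers and their quotients\<close>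

text \<open>
  The axioms of a Lie algebra over a field, relative to the carrier. They mirror the clauses of
  \<open>lie_eq\<close> one by one, so that these clauses can be checked in any such algebra.
\<close>

locale lie_algebra =
  fixes L :: "('k::field, 'a) glie"
  assumes zer_in: "zer L \<in> car L"
    and add_in: "x \<in> car L \<Longrightarrow> y \<in> car L \<Longrightarrow> add L x y \<in> car L"
    and smul_in: "x \<in> car L \<Longrightarrow> smul L c x \<in> car L"
    and brk_in: "x \<in> car L \<Longrightarrow> y \<in> car L \<Longrightarrow> brk L x y \<in> car L"
    and add_assoc: "x \<in> car L \<Longrightarrow> y \<in> car L \<Longrightarrow> z \<in> car L \<Longrightarrow>
        add L (add L x y) z = add L x (add L y z)"
    and add_commute: "x \<in> car L \<Longrightarrow> y \<in> car L \<Longrightarrow> add L x y = add L y x"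
    and add_zero: "x \<in> car L \<Longrightarrow> add L (zer L) x = x"
    and add_minus: "x \<in> car L \<Longrightarrow> add L x (smul L (- 1) x) = zer L"
    and scale_one: "x \<in> car L \<Longrightarrow> smul L 1 x = x"
    and scale_scale: "x \<in> car L \<Longrightarrow> smul L c (smul L d x) = smul L (c * d) x"
    and scale_add_right: "x \<in> car L \<Longrightarrow> y \<in> car L \<Longrightarrow>
        smul L c (add L x y) = add L (smul L c x) (smul L c y)"
    and scale_add_left: "x \<in> car L \<Longrightarrow> smul L (c + d) x = add L (smul L c x) (smul L d x)"
    and br_add_left: "x \<in> car L \<Longrightarrow> y \<in> car L \<Longrightarrow> z \<in> car L \<Longrightarrow>
        brk L (add L x y) z = add L (brk L x z) (brk L y z)"
    and br_add_right: "x \<in> car L \<Longrightarrow> y \<in> car L \<Longrightarrow> z \<in> car L \<Longrightarrow>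
        brk L z (add L x y) = add L (brk L z x) (brk L z y)"
    and br_scale_left: "x \<in> car L \<Longrightarrow> y \<in> car L \<Longrightarrow>
        brk L (smul L c x) y = smul L c (brk L x y)"
    and br_scale_right: "x \<in> car L \<Longrightarrow> y \<in> car L \<Longrightarrow>
        brk L x (smul L c y) = smul L c (brk L x y)"
    and br_self: "x \<in> car L \<Longrightarrow> brk L x x = zer L"
    and jacobi: "x \<in> car L \<Longrightarrow> y \<in> car L \<Longrightarrow> z \<in> car L \<Longrightarrow>
        add L (brk L x (brk L y z)) (add L (brk L y (brk L z x)) (brk L z (brk L x y))) = zer L"
begin

lemma add_zero_right: "x \<in> car L \<Longrightarrow> add L x (zer L) = x"
  using add_commute[of x "zer L"] by (simp add: add_zero zer_in)

lemma smul_zero: "smul L c (zer L) = zer L"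
proof -
  have "zer L = smul L (- 1) (zer L)"
    using add_minus[OF zer_in] add_zero[OF smul_in[OF zer_in]] by simp
  then have "smul L c (zer L) = smul L (- c) (zer L)" for c
    using scale_scale[OF zer_in, of c "- 1"] by simp
  moreover have "smul L c (zer L) = add L (smul L c (zer L)) (smul L c (zer L))"
    using scale_add_right[OF zer_in zer_in, of c] by (simp add: add_zero zer_in)
  moreover have "add L (smul L c (zer L)) (smul L (- c) (zer L)) = zer L"
    using add_minus[OF smul_in[OF zer_in]] by (simp add: scale_scale zer_in)
  ultimately show ?thesis by metis
qed

lemma cancel_left:
  assumes "x \<in> car L" "y \<in> car L" "z \<in> car L" "add L x y = add L x z"
  shows "y = z"
proof -
  have "add L (add L (smul L (- 1) x) x) y = add L (add L (smul L (- 1) x) x) z"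
    using assms by (simp add: add_assoc smul_in)
  then show ?thesis
    using assms add_minus[OF assms(1)] by (simp add: add_commute[of "smul L (- 1) x"] smul_in add_zero)
qed

lemma br_zero_right: "x \<in> car L \<Longrightarrow> brk L x (zer L) = zer L"
  using br_add_right[OF zer_in zer_in, of x]
  by (metis add_zero add_zero_right brk_in cancel_left zer_in)

lemma br_anti:
  assumes x: "x \<in> car L" and y: "y \<in> car L"
  shows "brk L x y = smul L (- 1) (brk L y x)"
proof -
  have "zer L = brk L (add L x y) (add L x y)"
    using br_self[OF add_in[OF x y]] by simp
  also have "\<dots> = add L (brk L x (add L x y)) (brk L y (add L x y))"
    using x y by (intro br_add_left add_in)
  also have "\<dots> = add L (brk L x y) (brk L y x)"
    using x y by (simp add: br_add_right brk_in br_self add_zero add_zero_right)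
  also have "\<dots> = add L (brk L y x) (brk L x y)"
    using x y by (simp add: add_commute brk_in)
  finally have "add L (brk L y x) (brk L x y) = zer L"
    by simp
  also have "\<dots> = add L (brk L y x) (smul L (- 1) (brk L y x))"
    using x y by (simp add: add_minus brk_in)
  finally show ?thesis
    using x y cancel_left brk_in smul_in by metis
qed

lemma add_swap:
  assumes "x \<in> car L" "i \<in> car L" "y \<in> car L" "j \<in> car L"
  shows "add L (add L x i) (add L y j) = add L (add L x y) (add L i j)"
  using assms by (metis add_assoc add_commute add_in)

lemma carrier_is_ideal: "lie_ideal L (car L)"
  by (simp add: lie_ideal_def zer_in add_in smul_in brk_in)

lemma ideal_gen_is_ideal:
  assumes "S \<subseteq> car L"
  shows "lie_ideal L (ideal_gen L S)"
  using carrier_is_ideal assms unfolding lie_ideal_def ideal_gen_def by auto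

lemma ideal_sum_is_ideal:
  assumes I: "lie_ideal L I" and K: "lie_ideal L K"
  shows "lie_ideal L (ideal_sum L I K)"
proof -
  have IL: "\<And>x. x \<in> I \<Longrightarrow> x \<in> car L" and KL: "\<And>x. x \<in> K \<Longrightarrow> x \<in> car L"
    using I K by (auto simp: lie_ideal_def)
  have "zer L = add L (zer L) (zer L)"
    by (simp add: add_zero zer_in)
  then have z: "zer L \<in> ideal_sum L I K"
    using I K unfolding ideal_sum_def lie_ideal_def by blast
  have a: "add L x y \<in> ideal_sum L I K" if xy: "x \<in> ideal_sum L I K" "y \<in> ideal_sum L I K" for x y
  proof -
    obtain i k i' k' where *: "x = add L i k" "y = add L i' k'" "i \<in> I" "k \<in> K" "i' \<in> I" "k' \<in> K"
      using xy unfolding ideal_sum_def by blast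
    then have "add L x y = add L (add L i i') (add L k k')"
      by (simp add: add_swap IL KL)
    then show ?thesis
      using * I K unfolding ideal_sum_def lie_ideal_def by blast
  qed
  have s: "smul L c x \<in> ideal_sum L I K" if xy: "x \<in> ideal_sum L I K" for c x
  proof -
    obtain i k where *: "x = add L i k" "i \<in> I" "k \<in> K"
      using xy unfolding ideal_sum_def by blast
    then have "smul L c x = add L (smul L c i) (smul L c k)"
      by (simp add: scale_add_right IL KL)
    then show ?thesis
      using * I K unfolding ideal_sum_def lie_ideal_def by blast
  qed
  have b: "brk L x y \<in> ideal_sum L I K" if xy: "x \<in> car L" "y \<in> ideal_sum L I K" for x y
  proof -
    obtain i k where *: "y = add L i k" "i \<in> I" "k \<in> K"
      using xy unfolding ideal_sum_def by blast
    then have "brk L x y = add L (brk L x i) (brk L x k)"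
      using xy by (simp add: br_add_right IL KL)
    then show ?thesis
      using * xy I K unfolding ideal_sum_def lie_ideal_def by blast
  qed
  have "ideal_sum L I K \<subseteq> car L"
    by (auto simp: ideal_sum_def add_in IL KL)
  then show ?thesis
    using z a s b by (simp add: lie_ideal_def)
qed

end

locale lie_algebra_ideal = lie_algebra +
  fixes I
  assumes ideal: "lie_ideal L I"
begin

abbreviation "cs \<equiv> lcoset L I"

lemma ideal_in: "i \<in> I \<Longrightarrow> i \<in> car L"
  and ideal_zer: "zer L \<in> I"
  and ideal_add: "i \<in> I \<Longrightarrow> j \<in> I \<Longrightarrow> add L i j \<in> I"
  and ideal_smul: "i \<in> I \<Longrightarrow> smul L c i \<in> I"
  and ideal_brk: "x \<in> car L \<Longrightarrow> i \<in> I \<Longrightarrow> brk L x i \<in> I"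
  using ideal by (auto simp: lie_ideal_def)

lemma ideal_brk_left: "x \<in> car L \<Longrightarrow> i \<in> I \<Longrightarrow> brk L i x \<in> I"
  using br_anti[of i x] ideal_brk ideal_smul ideal_in by simp

lemma lcoset_self: "x \<in> car L \<Longrightarrow> x \<in> cs x"
  unfolding lcoset_def using ideal_zer add_zero_right by force

lemma lcoset_zer: "cs (zer L) = I"
  by (force simp: lcoset_def add_zero ideal_in)

lemma quot_zer: "zer (quot L I) = cs (zer L)"
  by (simp add: quot_def lcoset_zer)

lemma quot_add:
  assumes "x \<in> car L" "y \<in> car L"
  shows "add (quot L I) (cs x) (cs y) = cs (add L x y)"
proof -
  have 1: "add L (add L x i) (add L y j) = add L (add L x y) (add L i j)"
    if "i \<in> I" "j \<in> I" for i j
    using that assms by (simp add: add_swap ideal_in)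
  have "{add L a b | a b. a \<in> cs x \<and> b \<in> cs y} = cs (add L x y)"
  proof (intro equalityI subsetI)
    fix z assume "z \<in> {add L a b | a b. a \<in> cs x \<and> b \<in> cs y}"
    then show "z \<in> cs (add L x y)"
      using 1 ideal_add unfolding lcoset_def by blast
  next
    fix z assume "z \<in> cs (add L x y)"
    then obtain i where i: "i \<in> I" "z = add L (add L x y) i"
      by (auto simp: lcoset_def)
    then have "z = add L x (add L y i)"
      using assms by (simp add: add_assoc ideal_in)
    then show "z \<in> {add L a b | a b. a \<in> cs x \<and> b \<in> cs y}"
      using i lcoset_self[OF assms(1)] unfolding lcoset_def by blast
  qed
  then show ?thesis by (simp add: quot_def)
qed

lemma quot_smul:
  assumes "x \<in> car L"
  shows "smul (quot L I) c (cs x) = cs (smul L c x)"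
proof -
  have "add L (smul L c (add L x i)) j = add L (smul L c x) (add L (smul L c i) j)"
    if "i \<in> I" "j \<in> I" for i j
    using that assms by (simp add: scale_add_right add_assoc ideal_in smul_in)
  then have "{add L (smul L c a) i | a i. a \<in> cs x \<and> i \<in> I} \<subseteq> cs (smul L c x)"
    using ideal_add ideal_smul unfolding lcoset_def by blast
  moreover have "cs (smul L c x) \<subseteq> {add L (smul L c a) i | a i. a \<in> cs x \<and> i \<in> I}"
    using lcoset_self[OF assms] unfolding lcoset_def by blast
  ultimately show ?thesis by (simp add: quot_def)
qed

lemma quot_brk:
  assumes "x \<in> car L" "y \<in> car L"
  shows "brk (quot L I) (cs x) (cs y) = cs (brk L x y)"
proof -
  have "add L (brk L (add L x i) (add L y j)) l
      = add L (brk L x y) (add L (brk L i y) (add L (brk L x j) (add L (brk L i j) l)))"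
    if "i \<in> I" "j \<in> I" "l \<in> I" for i j l
    using that assms by (simp add: br_add_left br_add_right add_assoc ideal_in brk_in add_in)
  then have "{add L (brk L a b) i | a b i. a \<in> cs x \<and> b \<in> cs y \<and> i \<in> I} \<subseteq> cs (brk L x y)"
    using assms unfolding lcoset_def
    by clarsimp (metis ideal_add ideal_brk ideal_brk_left ideal_in)
  moreover have "cs (brk L x y) \<subseteq> {add L (brk L a b) i | a b i. a \<in> cs x \<and> b \<in> cs y \<and> i \<in> I}"
    using lcoset_self[OF assms(1)] lcoset_self[OF assms(2)] unfolding lcoset_def by blast
  ultimately show ?thesis by (simp add: quot_def)
qed

lemma quot_car: "car (quot L I) = cs ` car L"
  by (simp add: quot_def)

lemma quot_pc: "pc (quot L I) k = cs ` pc L k"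
  by (simp add: quot_def)

lemma lie_algebra_quot: "lie_algebra (quot L I)"
proof -
  note [simp] = quot_car quot_zer quot_add quot_smul quot_brk zer_in add_in smul_in brk_in
  show ?thesis
  proof (unfold_locales, goal_cases)
    case 5 then show ?case by (auto simp: add_assoc)
  next
    case 6 then show ?case by (auto simp: add_commute)
  next
    case 7 then show ?case by (auto simp: add_zero)
  next
    case 8 then show ?case by (auto simp: add_minus)
  next
    case 9 then show ?case by (auto simp: scale_one)
  next
    case 10 then show ?case by (auto simp: scale_scale)
  next
    case 11 then show ?case by (auto simp: scale_add_right)
  next
    case 12 then show ?case by (auto simp: scale_add_left)
  next
    case 13 then show ?case by (auto simp: br_add_left)
  next
    case 14 then show ?case by (auto simp: br_add_right)
  next
    case 15 then show ?case by (auto simp: br_scale_left)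
  next
    case 16 then show ?case by (auto simp: br_scale_right)
  next
    case 17 then show ?case by (auto simp: br_self)
  next
    case 18 then show ?case by (auto simp: jacobi)
  qed auto
qed

end

section \<open>Evaluation of Lie terms\<close>

primrec lev :: "('k, 'a) glie \<Rightarrow> ('v \<Rightarrow> 'a) \<Rightarrow> ('k, 'v) lterm \<Rightarrow> 'a" where
  "lev L g TZero = zer L"
| "lev L g (TGen v) = g v"
| "lev L g (TAdd s t) = add L (lev L g s) (lev L g t)"
| "lev L g (TScale c s) = smul L c (lev L g s)"
| "lev L g (TBr s t) = brk L (lev L g s) (lev L g t)"

lemma lterms_simps [simp]:
  "TZero \<in> lterms W"
  "TGen v \<in> lterms W \<longleftrightarrow> v \<in> W"
  "TAdd s t \<in> lterms W \<longleftrightarrow> s \<in> lterms W \<and> t \<in> lterms W"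
  "TScale c s \<in> lterms W \<longleftrightarrow> s \<in> lterms W"
  "TBr s t \<in> lterms W \<longleftrightarrow> s \<in> lterms W \<and> t \<in> lterms W"
  by (auto simp: lterms_def)

lemma (in lie_algebra) lev_in:
  "t \<in> lterms W \<Longrightarrow> g ` W \<subseteq> car L \<Longrightarrow> lev L g t \<in> car L"
  by (induction t) (auto simp: zer_in add_in smul_in brk_in)

lemma glie_iso_lev:
  assumes "glie_iso \<phi> L L'" and "lie_algebra L" and "t \<in> lterms W" and "g ` W \<subseteq> car L"
    and "\<phi> (zer L) = zer L'"
  shows "\<phi> (lev L g t) = lev L' (\<phi> \<circ> g) t"
proof -
  interpret lie_algebra L by fact
  from assms(3) show ?thesis
    using assms(1) by (induction t) (auto simp: assms(5) glie_iso_def lev_in[OF _ assms(4)])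
qed

lemma (in lie_algebra_ideal) lev_quot:
  "t \<in> lterms W \<Longrightarrow> g ` W \<subseteq> car L \<Longrightarrow> lev (quot L I) (\<lambda>v. cs (g v)) t = cs (lev L g t)"
  by (induction t) (auto simp: quot_zer quot_add quot_smul quot_brk lev_in)

lemma (in lie_algebra) lev_sound:
  assumes "lie_eq sc W s t"
    and "\<And>v. g v \<in> car L"
    and "\<And>v w. v \<in> W \<Longrightarrow> w \<in> W \<Longrightarrow> g (v + w) = add L (g v) (g w)"
    and "\<And>c v. v \<in> W \<Longrightarrow> g (sc c v) = smul L c (g v)"
  shows "lev L g s = lev L g t"
proof -
  have [simp]: "lev L g u \<in> car L" for u
    using lev_in[of u UNIV g] assms(2) by (auto simp: lterms_def)
  from assms(1) show ?thesis
    by (induction) (simp_all add: assms add_assoc add_zero add_minus scale_one scale_scale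
        scale_add_right scale_add_left br_add_left br_add_right br_scale_left br_scale_right
        br_self jacobi add_commute)
qed

section \<open>The free Lie algebra\<close>

lemma lclass_eq:
  "s \<in> lterms W \<Longrightarrow> t \<in> lterms W \<Longrightarrow> lclass sc W s = lclass sc W t \<longleftrightarrow> lie_eq sc W s t"
  unfolding lclass_def using lie_eq.refl lie_eq.sym lie_eq.trans by blast

lemma lclass_eqI: "lie_eq sc W s t \<Longrightarrow> lclass sc W s = lclass sc W t"
  unfolding lclass_def using lie_eq.sym lie_eq.trans by blast

lemma free_lie_ops:
  assumes "s \<in> lterms W" "t \<in> lterms W"
  shows "add (free_lie sc W) (lclass sc W s) (lclass sc W t) = lclass sc W (TAdd s t)"
    and "smul (free_lie sc W) c (lclass sc W s) = lclass sc W (TScale c s)"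
    and "brk (free_lie sc W) (lclass sc W s) (lclass sc W t) = lclass sc W (TBr s t)"
proof -
  have self: "s \<in> lclass sc W s" "t \<in> lclass sc W t"
    using assms by (auto simp: lclass_def lie_eq.refl)
  have eq: "lclass sc W (TAdd s' t') = lclass sc W (TAdd s t)"
    "lclass sc W (TScale c s') = lclass sc W (TScale c s)"
    "lclass sc W (TBr s' t') = lclass sc W (TBr s t)"
    if "s' \<in> lclass sc W s" "t' \<in> lclass sc W t" for s' t'
  proof -
    have eqs: "lie_eq sc W s' s" "lie_eq sc W t' t"
      using that by (simp_all add: lclass_def lie_eq.sym)
    show "lclass sc W (TAdd s' t') = lclass sc W (TAdd s t)"
      by (intro lclass_eqI lie_eq.cong_add eqs)
    show "lclass sc W (TScale c s') = lclass sc W (TScale c s)"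
      by (intro lclass_eqI lie_eq.cong_scale eqs)
    show "lclass sc W (TBr s' t') = lclass sc W (TBr s t)"
      by (intro lclass_eqI lie_eq.cong_br eqs)
  qed
  have ne: "lclass sc W s \<noteq> {}" "lclass sc W t \<noteq> {}"
    using self by auto
  show "add (free_lie sc W) (lclass sc W s) (lclass sc W t) = lclass sc W (TAdd s t)"
    using ne eq(1) by (simp add: free_lie_def)
  show "smul (free_lie sc W) c (lclass sc W s) = lclass sc W (TScale c s)"
    using ne eq(2)[OF _ self(2)] by (simp add: free_lie_def)
  show "brk (free_lie sc W) (lclass sc W s) (lclass sc W t) = lclass sc W (TBr s t)"
    using ne eq(3) by (simp add: free_lie_def)
qed

lemma free_lie_car: "car (free_lie sc W) = lclass sc W ` lterms W"
  and free_lie_zer: "zer (free_lie sc W) = lclass sc W TZero"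
  and free_lie_pc: "pc (free_lie sc W) k = lclass sc W ` {t \<in> lterms W. homogeneous k t}"
  by (simp_all add: free_lie_def)

lemma lie_algebra_free_lie: "lie_algebra (free_lie sc W)"
  by unfold_locales
    (auto simp: free_lie_car free_lie_zer free_lie_ops lclass_eq intro: lie_eq.intros
      del: equalityI subsetI)

lemma lev_free_lie:
  "t \<in> lterms W \<Longrightarrow> lev (free_lie sc W) (\<lambda>v. lclass sc W (TGen v)) t = lclass sc W t"
  by (induction t) (simp_all add: free_lie_zer free_lie_ops)

section \<open>Lifting evaluations to iterated quotients of the free Lie algebra\<close>

text \<open>
  An algebra \<open>L\<close> generated by \<open>g ` W\<close> such that \<open>f\<close> extends to a homomorphism from \<open>L\<close> to \<open>N\<close>:
  every relation \<open>t = 0\<close> that holds in \<open>L\<close> also holds in \<open>N\<close>. Expressing the homomorphism through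
  terms avoids choosing representatives, and it makes the property easy to transport to the
  quotients of \<open>L\<close>, which are algebras of cosets of cosets.
\<close>

locale generated_lie_algebra = lie_algebra L + N: lie_algebra N
  for L :: "('k::field, 'a) glie" and N :: "('k, 'n) glie" +
  fixes W :: "'v set" and g :: "'v \<Rightarrow> 'a" and f :: "'v \<Rightarrow> 'n"
  assumes generated: "car L = lev L g ` lterms W"
    and generated_pc: "pc L k = lev L g ` {t \<in> lterms W. homogeneous k t}"
    and f_in: "f v \<in> car N"
    and lifts: "t \<in> lterms W \<Longrightarrow> lev L g t = zer L \<Longrightarrow> lev N f t = zer N"
begin

lemma g_in: "g ` W \<subseteq> car L"
proof
  fix x assume "x \<in> g ` W"
  then obtain v where "v \<in> W" "x = lev L g (TGen v)" by auto
  then show "x \<in> car L" unfolding generated by (metis imageI lterms_simps(2))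
qed

lemma levN_in [simp]: "lev N f t \<in> car N"
  using N.lev_in[of t UNIV f] f_in by (auto simp: lterms_def)

definition ker :: "'a set" where
  "ker = {lev L g t | t. t \<in> lterms W \<and> lev N f t = zer N}"

lemma ker_I: "t \<in> lterms W \<Longrightarrow> lev N f t = zer N \<Longrightarrow> lev L g t \<in> ker"
  by (auto simp: ker_def)

lemma ker_is_ideal: "lie_ideal L ker"
  unfolding lie_ideal_def
proof (intro conjI ballI allI)
  show "ker \<subseteq> car L"
    using generated by (auto simp: ker_def)
  show "zer L \<in> ker"
    using ker_I[of TZero] by simp
next
  fix x y assume "x \<in> ker" "y \<in> ker"
  then obtain s t where "x = lev L g s" "y = lev L g t" "s \<in> lterms W" "t \<in> lterms W"
    "lev N f s = zer N" "lev N f t = zer N"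
    by (auto simp: ker_def)
  then show "add L x y \<in> ker"
    using ker_I[of "TAdd s t"] by (simp add: N.add_zero N.zer_in)
next
  fix c x assume "x \<in> ker"
  then obtain s where "x = lev L g s" "s \<in> lterms W" "lev N f s = zer N"
    by (auto simp: ker_def)
  then show "smul L c x \<in> ker"
    using ker_I[of "TScale c s"] by (simp add: N.smul_zero)
next
  fix x y assume "x \<in> car L" "y \<in> ker"
  then obtain s t where "x = lev L g s" "y = lev L g t" "s \<in> lterms W" "t \<in> lterms W"
    "lev N f t = zer N"
    by (auto simp: ker_def generated)
  then show "brk L x y \<in> ker"
    using ker_I[of "TBr s t"] by (simp add: N.br_zero_right)
qed

lemma ideal_gen_le_ker: "S \<subseteq> ker \<Longrightarrow> ideal_gen L S \<subseteq> ker"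
  using ker_is_ideal by (auto simp: ideal_gen_def)

text \<open>
  The homomorphism theorem: an ideal inside the kernel of the extension of \<open>f\<close> may be divided out.
  Two terms with the same coset differ by an element of the kernel, which is represented by a term
  that vanishes in \<open>N\<close>, so the relation already comes from a relation in \<open>L\<close>.
\<close>

lemma generated_quot:
  assumes I: "lie_ideal L I" and "I \<subseteq> ker"
  shows "generated_lie_algebra (quot L I) N W (\<lambda>v. lcoset L I (g v)) f"
proof -
  interpret I: lie_algebra_ideal L I
    by unfold_locales (rule I)
  interpret Q: lie_algebra "quot L I"
    by (rule I.lie_algebra_quot)
  show ?thesis
  proof
    show "car (quot L I) = lev (quot L I) (\<lambda>v. lcoset L I (g v)) ` lterms W"
      by (auto simp: I.quot_car generated I.lev_quot[OF _ g_in] image_image)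
    show "pc (quot L I) k = lev (quot L I) (\<lambda>v. lcoset L I (g v)) ` {t \<in> lterms W. homogeneous k t}"
      for k
      by (auto simp: I.quot_pc generated_pc I.lev_quot[OF _ g_in] image_image)
    show "f v \<in> car N" for v by (rule f_in)
  next
    fix t assume t: "t \<in> lterms W" and "lev (quot L I) (\<lambda>v. lcoset L I (g v)) t = zer (quot L I)"
    then have "lcoset L I (lev L g t) = I"
      by (simp add: I.lev_quot[OF _ g_in] I.quot_zer I.lcoset_zer)
    then have "lev L g t \<in> ker"
      using assms(2) I.lcoset_self[OF lev_in[OF t g_in]] by auto
    then obtain s where s: "s \<in> lterms W" "lev L g t = lev L g s" "lev N f s = zer N"
      by (auto simp: ker_def)
    have "lev L g (TAdd t (TScale (- 1) s)) = zer L"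
      using s add_minus[OF lev_in[OF s(1) g_in]] by simp
    then have "lev N f (TAdd t (TScale (- 1) s)) = zer N"
      using s t by (intro lifts) auto
    then show "lev N f t = zer N"
      using s N.add_zero_right[OF levN_in] by (simp add: N.smul_zero)
  qed
qed

end

lemma generated_free_lie:
  assumes "lie_algebra N" and "\<And>v. f v \<in> car N"
    and "\<And>v w. v \<in> W \<Longrightarrow> w \<in> W \<Longrightarrow> f (v + w) = add N (f v) (f w)"
    and "\<And>c v. v \<in> W \<Longrightarrow> f (sc c v) = smul N c (f v)"
  shows "generated_lie_algebra (free_lie sc W) N W (\<lambda>v. lclass sc W (TGen v)) f"
proof -
  interpret N: lie_algebra N by fact
  interpret lie_algebra "free_lie sc W" by (rule lie_algebra_free_lie)
  show ?thesis
  proof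
    show "car (free_lie sc W) = lev (free_lie sc W) (\<lambda>v. lclass sc W (TGen v)) ` lterms W"
      by (auto simp: free_lie_car lev_free_lie)
    show "pc (free_lie sc W) k = lev (free_lie sc W) (\<lambda>v. lclass sc W (TGen v)) `
        {t \<in> lterms W. homogeneous k t}" for k
      by (auto simp: free_lie_pc lev_free_lie)
    show "f v \<in> car N" for v by (rule assms(2))
  next
    fix t assume t: "t \<in> lterms W"
      and "lev (free_lie sc W) (\<lambda>v. lclass sc W (TGen v)) t = zer (free_lie sc W)"
    then have "lie_eq sc W t TZero"
      by (simp add: lev_free_lie free_lie_zer lclass_eq)
    from N.lev_sound[OF this] assms(2-4) show "lev N f t = zer N"
      by simp
  qed
qed

section \<open>The universal property of totally nondegenerate algebras\<close>

lemma lev_cong: "t \<in> lterms W \<Longrightarrow> (\<And>v. v \<in> W \<Longrightarrow> g v = g' v) \<Longrightarrow> lev L g t = lev L g' t"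
  by (induction t) auto

lemma ideal_sum_le:
  assumes "lie_ideal L K" "I \<subseteq> K" "I' \<subseteq> K"
  shows "ideal_sum L I I' \<subseteq> K"
  using assms unfolding ideal_sum_def lie_ideal_def by blast

text \<open>
  If \<open>f\<close> is linear on \<open>V\<^sup>\<complex>\<close>, kills \<open>[V\<^sup>1\<^sup>0, V\<^sup>1\<^sup>0]\<close> and \<open>[V\<^sup>0\<^sup>1, V\<^sup>0\<^sup>1]\<close>, and takes values in an algebra
  in which all products of length at least \<open>\<mu>\<close> vanish, then it extends to a Lie homomorphism from
  \<open>\<mm>\<^sup>\<complex>\<close>. Starting from the free Lie algebra, three ideals are divided out: the truncation
  ideal, the sum of the two bracket ideals, and the ideal in the lowest degree \<open>-\<mu>\<close>. The last one lies
  in the kernel because the target has depth less than \<open>\<mu>\<close>; this is how total nondegeneracy enters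
  the proof.
\<close>

lemma universal_property:
  fixes br :: "'m::real_vector \<Rightarrow> 'm \<Rightarrow> 'm" and N :: "(complex, 'n) glie" and gr
  defines "W \<equiv> gr 1 \<times> gr 1" and "M \<equiv> complexification br gr"
  assumes tn: "totally_nondegenerate \<mu> br gr J"
    and N: "lie_algebra N" and f_in: "\<And>v. f v \<in> car N"
    and f_add: "\<And>v w. v \<in> W \<Longrightarrow> w \<in> W \<Longrightarrow> f (v + w) = add N (f v) (f w)"
    and f_scale: "\<And>c v. v \<in> W \<Longrightarrow> f (cscale c v) = smul N c (f v)"
    and f10: "\<And>v w. v \<in> V10 (gr 1) J \<Longrightarrow> w \<in> V10 (gr 1) J \<Longrightarrow> brk N (f v) (f w) = zer N"
    and f01: "\<And>v w. v \<in> V01 (gr 1) J \<Longrightarrow> w \<in> V01 (gr 1) J \<Longrightarrow> brk N (f v) (f w) = zer N"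
    and depth: "\<And>k t. \<mu> \<le> k \<Longrightarrow> homogeneous k t \<Longrightarrow> lev N f t = zer N"
  obtains F where
    "\<And>x y. F (x + y) = add N (F x) (F y)" "\<And>c x. F (cscale c x) = smul N c (F x)"
    "\<And>x y. F (brk M x y) = brk N (F x) (F y)" "\<And>v. v \<in> W \<Longrightarrow> F v = f v"
    "\<And>k x. x \<in> gr k \<times> gr k \<Longrightarrow> \<exists>t. homogeneous k t \<and> F x = lev N f t"
proof -
  interpret N: lie_algebra N by (rule N)
  let ?FL = "free_lie cscale W" and ?UF = "universal_fundamental \<mu> cscale W"
  let ?UC = "universal_CR \<mu> (gr 1) J"
  obtain I \<phi> where I: "lie_ideal ?UC I" "I \<subseteq> pc ?UC \<mu>"
    and iso: "glie_iso \<phi> (quot ?UC I) M"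
    and \<phi>_gen: "\<And>v. v \<in> W \<Longrightarrow> \<phi> (lcoset ?UC I (universal_CR_gen \<mu> (gr 1) J v)) = v"
    using tn unfolding totally_nondegenerate_def W_def M_def by blast
  interpret FL: generated_lie_algebra ?FL N W "\<lambda>v. lclass cscale W (TGen v)" f
    by (rule generated_free_lie[OF N f_in f_add f_scale])
  have "truncation_ideal \<mu> cscale W \<subseteq> FL.ker"
    unfolding truncation_ideal_def
  proof (rule FL.ideal_gen_le_ker, rule UN_least)
    fix k assume "k \<in> {\<mu><..}"
    then show "pc ?FL k \<subseteq> FL.ker"
      by (auto simp: FL.generated_pc intro!: FL.ker_I depth[of k])
  qed
  moreover have "lie_ideal ?FL (truncation_ideal \<mu> cscale W)"
    unfolding truncation_ideal_def
    by (rule FL.ideal_gen_is_ideal) (auto simp: FL.generated_pc FL.generated)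
  ultimately interpret UF: generated_lie_algebra ?UF N W "universal_gen \<mu> cscale W" f
    unfolding universal_fundamental_def universal_gen_def by (rule FL.generated_quot[rotated])
  have gen_in: "brk ?UF (universal_gen \<mu> cscale W v) (universal_gen \<mu> cscale W w) \<in> UF.ker"
    if "v \<in> W" "w \<in> W" "brk N (f v) (f w) = zer N" for v w
    using UF.ker_I[of "TBr (TGen v) (TGen w)"] that by simp
  have sub: "{brk ?UF (universal_gen \<mu> cscale W v) (universal_gen \<mu> cscale W w) | v w.
      v \<in> V10 (gr 1) J \<and> w \<in> V10 (gr 1) J} \<subseteq> UF.ker"
    "{brk ?UF (universal_gen \<mu> cscale W v) (universal_gen \<mu> cscale W w) | v w.
      v \<in> V01 (gr 1) J \<and> w \<in> V01 (gr 1) J} \<subseteq> UF.ker"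
    using gen_in f10 f01 by (force simp: V10_def V01_def W_def)+
  have ker_car: "UF.ker \<subseteq> car ?UF"
    using UF.ker_is_ideal by (simp add: lie_ideal_def)
  have "CR_ideal \<mu> (gr 1) J \<subseteq> UF.ker"
    unfolding CR_ideal_def bracket_ideal_def Let_def W_def[symmetric]
    by (intro ideal_sum_le UF.ker_is_ideal UF.ideal_gen_le_ker sub)
  moreover have "lie_ideal ?UF (CR_ideal \<mu> (gr 1) J)"
    unfolding CR_ideal_def bracket_ideal_def Let_def W_def[symmetric]
    by (intro UF.ideal_sum_is_ideal UF.ideal_gen_is_ideal order.trans[OF sub(1) ker_car]
        order.trans[OF sub(2) ker_car])
  ultimately interpret UC: generated_lie_algebra ?UC N W "universal_CR_gen \<mu> (gr 1) J" f
    unfolding universal_CR_def universal_CR_gen_def W_def[symmetric]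
    by (rule UF.generated_quot[rotated])
  have "pc ?UC \<mu> \<subseteq> UC.ker"
    unfolding UC.generated_pc using UC.ker_I depth[OF order.refl] by blast
  with I(2) have "I \<subseteq> UC.ker" by (rule order.trans)
  then interpret Q: generated_lie_algebra "quot ?UC I" N W
      "\<lambda>v. lcoset ?UC I (universal_CR_gen \<mu> (gr 1) J v)" f
    by (rule UC.generated_quot[OF I(1)])
  let ?g = "\<lambda>v. lcoset ?UC I (universal_CR_gen \<mu> (gr 1) J v)"
  have bij: "bij_betw \<phi> (car (quot ?UC I)) UNIV"
    using iso by (simp add: glie_iso_def M_def complexification_def)
  have \<phi>0: "\<phi> (zer (quot ?UC I)) = 0"
  proof -
    have "\<phi> (add (quot ?UC I) (zer (quot ?UC I)) (zer (quot ?UC I)))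
        = \<phi> (zer (quot ?UC I)) + \<phi> (zer (quot ?UC I))"
      using iso Q.zer_in by (auto simp: glie_iso_def M_def complexification_def)
    then show ?thesis
      unfolding Q.add_zero[OF Q.zer_in] by (simp only: add_cancel_right_right)
  qed
  have \<phi>_lev: "\<phi> (lev (quot ?UC I) ?g t) = lev M (\<lambda>v. v) t" if t: "t \<in> lterms W" for t
  proof -
    have "\<phi> (lev (quot ?UC I) ?g t) = lev M (\<phi> \<circ> ?g) t"
      by (rule glie_iso_lev[OF iso Q.lie_algebra_axioms t Q.g_in])
        (unfold \<phi>0, simp add: M_def complexification_def)
    also have "\<dots> = lev M (\<lambda>v. v) t"
      by (rule lev_cong[OF t]) (unfold o_def, rule \<phi>_gen)
    finally show ?thesis .
  qed
  \<comment> \<open>relations of \<open>\<mm>\<^sup>\<complex>\<close> are relations of the iterated quotient, hence of \<open>N\<close>\<close>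
  have eq: "lev N f s = lev N f t"
    if s: "s \<in> lterms W" and t: "t \<in> lterms W" and st: "lev M (\<lambda>v. v) s = lev M (\<lambda>v. v) t" for s t
  proof -
    have "lev (quot ?UC I) ?g s = lev (quot ?UC I) ?g t"
      using bij st \<phi>_lev[OF s] \<phi>_lev[OF t] Q.lev_in[OF s Q.g_in] Q.lev_in[OF t Q.g_in]
      by (metis bij_betw_imp_inj_on inj_onD)
    then have "lev (quot ?UC I) ?g (TAdd s (TScale (- 1) t)) = zer (quot ?UC I)"
      using Q.add_minus[OF Q.lev_in[OF t Q.g_in]] by simp
    then have "lev N f (TAdd s (TScale (- 1) t)) = zer N"
      using s t by (intro Q.lifts) auto
    then have "add N (lev N f t) (add N (smul N (- 1) (lev N f t)) (lev N f s)) = lev N f t"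
      by (simp add: N.add_commute N.add_zero_right N.smul_in)
    then show ?thesis
      by (simp add: N.add_assoc[symmetric] N.add_minus N.add_zero N.smul_in)
  qed
  define F where "F x = lev N f (SOME t. t \<in> lterms W \<and> lev M (\<lambda>v. v) t = x)" for x
  have F: "F (lev M (\<lambda>v. v) t) = lev N f t" if "t \<in> lterms W" for t
    unfolding F_def using someI[of "\<lambda>s. s \<in> lterms W \<and> lev M (\<lambda>v. v) s = lev M (\<lambda>v. v) t" t] that eq
    by blast
  have onto: "\<exists>t\<in>lterms W. x = lev M (\<lambda>v. v) t" for x
  proof -
    have "x \<in> \<phi> ` car (quot ?UC I)" using bij by (simp add: bij_betw_def)
    then obtain t where "t \<in> lterms W" "x = \<phi> (lev (quot ?UC I) ?g t)"
      unfolding Q.generated by blast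
    then show ?thesis using \<phi>_lev by blast
  qed
  show ?thesis
  proof (rule that)
    fix x y c
    obtain s t where st: "s \<in> lterms W" "t \<in> lterms W" "x = lev M (\<lambda>v. v) s" "y = lev M (\<lambda>v. v) t"
      using onto by metis
    show "F (x + y) = add N (F x) (F y)"
      using F[of "TAdd s t"] st F by (simp add: M_def complexification_def)
    show "F (brk M x y) = brk N (F x) (F y)"
      using F[of "TBr s t"] st F by simp
    show "F (cscale c x) = smul N c (F x)"
      using F[of "TScale c s"] st F by (simp add: M_def complexification_def)
  next
    fix v assume "v \<in> W"
    then show "F v = f v" using F[of "TGen v"] by simp
  next
    fix k x assume "x \<in> gr k \<times> gr k"
    then have "x \<in> \<phi> ` pc (quot ?UC I) k"
      using iso by (simp add: glie_iso_def M_def complexification_def)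
    then show "\<exists>t. homogeneous k t \<and> F x = lev N f t"
      unfolding Q.generated_pc using \<phi>_lev F by fastforce
  qed
qed

section \<open>The filiform model algebra\<close>

text \<open>
  The pair \<open>(a, p)\<close> stands for \<open>a t + p\<^sub>0 e\<^sub>0 + \<dots> + p\<^sub>k e\<^sub>k\<close>, where the only nonzero brackets of the
  basis vectors are \<open>[t, e\<^sub>i] = e\<^sub>i\<^sub>+\<^sub>1\<close> for \<open>i < k\<close>; \<open>t\<close> has degree \<open>-1\<close> and \<open>e\<^sub>i\<close> has degree \<open>-(i+1)\<close>.
  Coefficients with index above \<open>k\<close> carry no brackets, and they vanish on everything generated in
  degree \<open>-1\<close>.
\<close>

definition filiform :: "nat \<Rightarrow> (complex, complex \<times> (nat \<Rightarrow> complex)) glie" where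
  "filiform k =
     \<lparr> car = UNIV,
       add = (\<lambda>(a, p) (b, q). (a + b, \<lambda>i. p i + q i)),
       zer = (0, \<lambda>_. 0),
       smul = (\<lambda>c (a, p). (c * a, \<lambda>i. c * p i)),
       brk = (\<lambda>(a, p) (b, q). (0, \<lambda>i. if 0 < i \<and> i \<le> k then a * q (i - 1) - b * p (i - 1) else 0)),
       pc = (\<lambda>j. {(a, p). (a \<noteq> 0 \<longrightarrow> j = 1) \<and> (\<forall>i. p i \<noteq> 0 \<longrightarrow> j = Suc i \<and> i \<le> k)}) \<rparr>"

lemma filiform_ops:
  "zer (filiform k) = (0, \<lambda>_. 0)"
  "add (filiform k) (a, p) (b, q) = (a + b, \<lambda>i. p i + q i)"
  "smul (filiform k) c (a, p) = (c * a, \<lambda>i. c * p i)"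
  "brk (filiform k) (a, p) (b, q)
    = (0, \<lambda>i. if 0 < i \<and> i \<le> k then a * q (i - 1) - b * p (i - 1) else 0)"
  "car (filiform k) = UNIV"
  by (simp_all add: filiform_def)

lemma lie_algebra_filiform: "lie_algebra (filiform k)"
  by unfold_locales (auto simp: filiform_def fun_eq_iff algebra_simps)

lemma filiform_pc_iff:
  "(a, p) \<in> pc (filiform k) j \<longleftrightarrow>
    (a \<noteq> 0 \<longrightarrow> j = 1) \<and> (\<forall>i. p i \<noteq> 0 \<longrightarrow> j = Suc i \<and> i \<le> k)"
  by (simp add: filiform_def)

lemma filiform_homogeneous:
  assumes "homogeneous j t" and "\<And>v. f v \<in> pc (filiform k) 1"
  shows "lev (filiform k) f t \<in> pc (filiform k) j"
  using assms(1)
proof induction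
  case (2 v) then show ?case using assms(2) by simp
next
  case (3 j s t)
  obtain a p b q where *: "lev (filiform k) f s = (a, p)" "lev (filiform k) f t = (b, q)"
    by (metis surj_pair)
  have ab: "a \<noteq> 0 \<or> b \<noteq> 0 \<longrightarrow> j = 1"
    and pq: "p i \<noteq> 0 \<or> q i \<noteq> 0 \<longrightarrow> j = Suc i \<and> i \<le> k" for i
    using 3(3,4) unfolding * filiform_pc_iff by blast+
  have "(a + b, \<lambda>i. p i + q i) \<in> pc (filiform k) j"
    unfolding filiform_pc_iff using ab pq by (metis add_0)
  then show ?case by (simp add: * filiform_ops)
next
  case (4 j s c)
  obtain a p where *: "lev (filiform k) f s = (a, p)"
    by (metis surj_pair)
  have "(c * a, \<lambda>i. c * p i) \<in> pc (filiform k) j"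
    using 4(2) unfolding * filiform_pc_iff by simp
  then show ?case by (simp add: * filiform_ops)
next
  case (5 j s j' t)
  obtain a p b q where *: "lev (filiform k) f s = (a, p)" "lev (filiform k) f t = (b, q)"
    by (metis surj_pair)
  have ab: "a \<noteq> 0 \<longrightarrow> j = 1" "b \<noteq> 0 \<longrightarrow> j' = 1"
    and pq: "p i \<noteq> 0 \<longrightarrow> j = Suc i" "q i \<noteq> 0 \<longrightarrow> j' = Suc i" for i
    using 5(3,4) unfolding * filiform_pc_iff by blast+
  have "j + j' = Suc i" if "0 < i" "a * q (i - 1) - b * p (i - 1) \<noteq> 0" for i
  proof -
    have "(a \<noteq> 0 \<and> q (i - 1) \<noteq> 0) \<or> (b \<noteq> 0 \<and> p (i - 1) \<noteq> 0)"
      using that(2) by auto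
    then show ?thesis
      using ab pq[of "i - 1"] that(1) by auto
  qed
  then have "(0, \<lambda>i. if 0 < i \<and> i \<le> k then a * q (i - 1) - b * p (i - 1) else 0)
      \<in> pc (filiform k) (j + j')"
    unfolding filiform_pc_iff by auto
  then show ?case by (simp add: * filiform_ops)
qed (simp_all add: filiform_def)


section \<open>Complexification and linear functionals\<close>

locale complex_space = vector_space sc
  for sc :: "complex \<Rightarrow> 'c::ab_group_add \<Rightarrow> 'c"
begin

definition functional :: "('c \<Rightarrow> complex) \<Rightarrow> bool" where
  "functional \<alpha> \<longleftrightarrow> (\<forall>x y. \<alpha> (x + y) = \<alpha> x + \<alpha> y) \<and> (\<forall>c x. \<alpha> (sc c x) = c * \<alpha> x)"

lemma functional_zero: "functional \<alpha> \<Longrightarrow> \<alpha> 0 = 0"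
  by (metis functional_def add_cancel_left_right add_0)

lemma functional_extend:
  assumes "\<not> local.dependent S"
  obtains \<alpha> where "functional \<alpha>" "\<And>x. x \<in> S \<Longrightarrow> \<alpha> x = h x"
proof -
  interpret vp: vector_space_pair sc "(*) :: complex \<Rightarrow> complex \<Rightarrow> complex"
    by unfold_locales (auto simp: algebra_simps)
  obtain \<alpha> where a: "Vector_Spaces.linear sc (*) \<alpha>" "\<forall>x\<in>S. \<alpha> x = h x"
    using vp.linear_independent_extend[OF assms, of h] by auto
  interpret l: Vector_Spaces.linear sc "(*)" \<alpha> by (rule a(1))
  have "functional \<alpha>"
    by (simp add: functional_def l.add l.scale)
  then show ?thesis using a(2) that by blast
qed

lemma functional_separating:
  assumes "w \<noteq> 0"
  obtains \<alpha> where "functional \<alpha>" "\<alpha> w = c"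
proof -
  have "\<not> local.dependent {w}" using assms by simp
  from functional_extend[OF this, of "\<lambda>_. c"] show ?thesis using that by auto
qed

lemma functional_separating2:
  assumes "w \<noteq> 0" "\<And>c. a \<noteq> sc c w"
  obtains \<alpha> where "functional \<alpha>" "\<alpha> w = c" "\<alpha> a = d"
proof -
  have "a \<notin> local.span {w}" using assms(2) by (auto simp: span_singleton)
  then have "\<not> local.dependent {a, w}" using assms(1) by (simp add: independent_insert)
  from functional_extend[OF this, of "\<lambda>x. if x = w then c else d"] obtain \<alpha> where
    "functional \<alpha>" "\<And>x. x \<in> {a, w} \<Longrightarrow> \<alpha> x = (if x = w then c else d)" by blast
  moreover have "a \<noteq> w" using assms(2)[of 1] by auto
  ultimately show ?thesis using that by auto
qed

end

text \<open>
  The complex bilinear extension of a real bilinear map.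
\<close>

definition complexify :: "('m::real_vector \<Rightarrow> 'm \<Rightarrow> 'm) \<Rightarrow> 'm \<times> 'm \<Rightarrow> 'm \<times> 'm \<Rightarrow> 'm \<times> 'm" where
  "complexify B = (\<lambda>(x, y) (x', y'). (B x x' - B y y', B x y' + B y x'))"

lemma brk_complexification: "brk (complexification br gr) = complexify br"
  by (simp add: complexification_def complexify_def)

lemma complex_space_cscale: "complex_space cscale"
  by unfold_locales (auto simp: cscale_def algebra_simps)

definition eigenspace :: "'m::real_vector set \<Rightarrow> ('m \<Rightarrow> 'm) \<Rightarrow> complex \<Rightarrow> ('m \<times> 'm) set" where
  "eigenspace V J \<epsilon> = {(x, y). x \<in> V \<and> y \<in> V \<and> (J x, J y) = cscale \<epsilon> (x, y)}"

lemma V10_eigenspace: "V10 V J = eigenspace V J \<i>"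
  and V01_eigenspace: "V01 V J = eigenspace V J (- \<i>)"
  by (simp_all add: V10_def V01_def eigenspace_def)

text \<open>
  For \<open>\<epsilon> = \<plusminus>\<i>\<close>, where \<open>\<epsilon>\<^sup>-\<^sup>1 = - \<epsilon>\<close>, this is \<open>(1 + \<epsilon>\<^sup>-\<^sup>1 J) / 2\<close>.
\<close>

definition eigenprojection :: "('m::real_vector \<Rightarrow> 'm) \<Rightarrow> complex \<Rightarrow> 'm \<times> 'm \<Rightarrow> 'm \<times> 'm" where
  "eigenprojection J \<epsilon> z = cscale (1/2) (z - cscale \<epsilon> (map_prod J J z))"

lemma eigenprojection_eigenspace:
  assumes "\<epsilon> = \<i> \<or> \<epsilon> = - \<i>" and "z \<in> eigenspace V J \<epsilon>"
  shows "eigenprojection J \<epsilon> z = z" "eigenprojection J (- \<epsilon>) z = 0"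
proof -
  interpret complex_space cscale by (rule complex_space_cscale)
  have "map_prod J J z = cscale \<epsilon> z"
    using assms(2) by (auto simp: eigenspace_def)
  then have p: "cscale \<delta> (map_prod J J z) = cscale (\<delta> * \<epsilon>) z" for \<delta>
    by simp
  have e: "\<epsilon> * \<epsilon> = - 1" using assms(1) by auto
  have "cscale (1/2) (z + z) = z"
    using scale_left_distrib[of "1/2" "1/2" z] by (simp add: scale_right_distrib)
  then show "eigenprojection J \<epsilon> z = z" "eigenprojection J (- \<epsilon>) z = 0"
    unfolding eigenprojection_def p by (simp_all add: e)
qed

lemma eigenprojection_linear:
  assumes J: "complex_structure_on V J" and zz: "z \<in> V \<times> V" "z' \<in> V \<times> V" and V: "subspace V"
  shows "eigenprojection J \<epsilon> (z + z') = eigenprojection J \<epsilon> z + eigenprojection J \<epsilon> z'"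
    and "eigenprojection J \<epsilon> (cscale c z) = cscale c (eigenprojection J \<epsilon> z)"
proof -
  interpret complex_space cscale by (rule complex_space_cscale)
  have Ja: "J (x + y) = J x + J y" and Jr: "J (r *\<^sub>R x) = r *\<^sub>R J x" and Jm: "J (- x) = - J x"
    if "x \<in> V" "y \<in> V" for x y r
  proof -
    show "J (x + y) = J x + J y" and *: "J (r *\<^sub>R x) = r *\<^sub>R J x" for r
      using J that unfolding complex_structure_on_def by blast+
    show "J (- x) = - J x" using *[of "- 1"] by simp
  qed
  have "map_prod J J (z + z') = map_prod J J z + map_prod J J z'"
    using zz Ja by (cases z; cases z') auto
  then show "eigenprojection J \<epsilon> (z + z') = eigenprojection J \<epsilon> z + eigenprojection J \<epsilon> z'"
    by (simp add: eigenprojection_def scale_right_distrib scale_right_diff_distrib algebra_simps)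
  have "map_prod J J (cscale c z) = cscale c (map_prod J J z)"
  proof (cases z)
    case (Pair x y)
    then have "x \<in> V" "y \<in> V" using zz by auto
    moreover from this have "r *\<^sub>R x \<in> V" "r *\<^sub>R y \<in> V" "- (r *\<^sub>R y) \<in> V" for r
      using V by (auto intro: real_vector.subspace_scale real_vector.subspace_neg)
    ultimately show ?thesis
      using Ja[of "Re c *\<^sub>R x" "- (Im c *\<^sub>R y)"]
      by (simp add: Pair cscale_def Ja Jr Jm)
  qed
  then show "eigenprojection J \<epsilon> (cscale c z) = cscale c (eigenprojection J \<epsilon> z)"
    by (simp add: eigenprojection_def scale_right_diff_distrib mult.commute)
qed

text \<open>
  The part of the freeness of \<open>\<mm>\<^sup>\<complex>\<close> that is used below. For linear functionals \<open>\<alpha>\<close> and \<open>\<eta>\<close>, the map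
  \<open>w \<mapsto> \<alpha>(w) t\<close>, \<open>v \<mapsto> \<eta>(v) e\<^sub>0\<close> on the two eigenspaces extends to a homomorphism into the filiform
  algebra, and \<open>g i\<close> reads off the coefficient of \<open>e\<^sub>i\<close>. Thus
  \<open>g k [w\<^sub>1, [\<dots>, [w\<^sub>k, v]]] = \<alpha>(w\<^sub>1) \<dots> \<alpha>(w\<^sub>k) \<eta>(v)\<close>: letting \<open>\<alpha>\<close> and \<open>\<eta>\<close> vary, such elements are told
  apart like elements of \<open>S\<^sup>k W\<^sub>0 \<otimes> W\<^sub>1\<close>, viewed as polynomial functions.
\<close>

lemma filiform_quotient:
  fixes br :: "'m::real_vector \<Rightarrow> 'm \<Rightarrow> 'm"
  assumes J: "complex_structure_on (gr 1) J" and V: "subspace (gr 1)"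
    and tn: "totally_nondegenerate (Suc (Suc k)) br gr J"
    and \<epsilon>: "\<epsilon> = \<i> \<or> \<epsilon> = - \<i>"
    and \<alpha>: "complex_space.functional cscale \<alpha>" and \<eta>: "complex_space.functional cscale \<eta>"
  shows "\<exists>g. (\<forall>i. complex_space.functional cscale (g i)) \<and>
    (\<forall>v\<in>eigenspace (gr 1) J (- \<epsilon>). g 0 v = \<eta> v) \<and>
    (\<forall>i<k. \<forall>w\<in>eigenspace (gr 1) J \<epsilon>. \<forall>u. g (Suc i) (complexify br w u) = \<alpha> w * g i u) \<and>
    (\<forall>i. \<forall>v\<in>eigenspace (gr 1) J (- \<epsilon>). \<forall>j\<ge>2. \<forall>u\<in>gr j \<times> gr j. g i (complexify br v u) = 0)"
proof -
  interpret cs: complex_space cscale by (rule complex_space_cscale)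
  define f where "f z = (\<alpha> (eigenprojection J \<epsilon> z),
    \<lambda>i::nat. if i = 0 then \<eta> (eigenprojection J (- \<epsilon>) z) else 0)" for z
  have \<alpha>l: "\<alpha> (x + y) = \<alpha> x + \<alpha> y" "\<alpha> (cscale c x) = c * \<alpha> x"
    and \<eta>l: "\<eta> (x + y) = \<eta> x + \<eta> y" "\<eta> (cscale c x) = c * \<eta> x" for x y c
    using \<alpha> \<eta> unfolding cs.functional_def by blast+
  have \<alpha>0: "\<alpha> 0 = 0" and \<eta>0: "\<eta> 0 = 0"
    using \<alpha> \<eta> cs.functional_zero by blast+
  have f_eig: "f w = (\<alpha> w, \<lambda>_. 0)" if "w \<in> eigenspace (gr 1) J \<epsilon>" for w
    using eigenprojection_eigenspace[OF \<epsilon> that] by (simp add: f_def \<eta>0 fun_eq_iff)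
  have f_eig': "f v = (0, \<lambda>i. if i = 0 then \<eta> v else 0)" if "v \<in> eigenspace (gr 1) J (- \<epsilon>)" for v
    using eigenprojection_eigenspace[of "- \<epsilon>" v] that \<epsilon> by (force simp: f_def \<alpha>0)
  have f_pc: "f v \<in> pc (filiform k) 1" for v
    unfolding f_def filiform_pc_iff by auto
  have low: "lev (filiform k) f t = zer (filiform k)" if "Suc (Suc k) \<le> j" "homogeneous j t" for j t
  proof -
    obtain a p where ap: "lev (filiform k) f t = (a, p)" by (metis surj_pair)
    then have "(a, p) \<in> pc (filiform k) j"
      using filiform_homogeneous[OF that(2), of f k] f_pc by simp
    then have "a = 0" "p i = 0" for i
      using that(1) unfolding filiform_pc_iff by force+
    then show ?thesis by (simp add: ap filiform_ops fun_eq_iff)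
  qed
  have comm: "brk (filiform k) (f v) (f w) = zer (filiform k)"
    if "v \<in> eigenspace (gr 1) J \<delta>" "w \<in> eigenspace (gr 1) J \<delta>" "\<delta> = \<epsilon> \<or> \<delta> = - \<epsilon>" for v w \<delta>
    using that by (auto simp: f_eig f_eig' filiform_ops fun_eq_iff)
  obtain F where F_add: "\<And>x y. F (x + y) = add (filiform k) (F x) (F y)"
    and F_scale: "\<And>c x. F (cscale c x) = smul (filiform k) c (F x)"
    and F_brk: "\<And>x y. F (complexify br x y) = brk (filiform k) (F x) (F y)"
    and F_gen: "\<And>v. v \<in> gr 1 \<times> gr 1 \<Longrightarrow> F v = f v"
    and F_pc: "\<And>j x. x \<in> gr j \<times> gr j \<Longrightarrow> \<exists>t. homogeneous j t \<and> F x = lev (filiform k) f t"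
  proof (rule universal_property[OF tn lie_algebra_filiform, where f = f])
    show "f v \<in> car (filiform k)" for v by (simp add: filiform_ops)
    show "f (v + w) = add (filiform k) (f v) (f w)" if "v \<in> gr 1 \<times> gr 1" "w \<in> gr 1 \<times> gr 1" for v w
      by (auto simp: f_def filiform_ops eigenprojection_linear(1)[OF J that V] \<alpha>l \<eta>l fun_eq_iff)
    show "f (cscale c v) = smul (filiform k) c (f v)" if "v \<in> gr 1 \<times> gr 1" for c v
      by (auto simp: f_def filiform_ops eigenprojection_linear(2)[OF J that that V] \<alpha>l \<eta>l fun_eq_iff)
    show "brk (filiform k) (f v) (f w) = zer (filiform k)"
      if "v \<in> V10 (gr 1) J" "w \<in> V10 (gr 1) J" for v w
      using comm[of v "\<i>" w] that \<epsilon> by (auto simp: V10_eigenspace)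
    show "brk (filiform k) (f v) (f w) = zer (filiform k)"
      if "v \<in> V01 (gr 1) J" "w \<in> V01 (gr 1) J" for v w
      using comm[of v "- \<i>" w] that \<epsilon> by (auto simp: V01_eigenspace)
    show "lev (filiform k) f t = zer (filiform k)" if "Suc (Suc k) \<le> j" "homogeneous j t" for j t
      by (rule low[OF that])
  qed (auto simp: brk_complexification)
  have sub: "z \<in> gr 1 \<times> gr 1" if "z \<in> eigenspace (gr 1) J \<delta>" for z \<delta>
    using that by (auto simp: eigenspace_def)
  have fst0: "fst (F u) = 0" if j: "2 \<le> j" and u: "u \<in> gr j \<times> gr j" for u j
  proof -
    obtain t where t: "homogeneous j t" "F u = lev (filiform k) f t" using F_pc[OF u] by blast
    obtain a p where ap: "F u = (a, p)" by (metis surj_pair)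
    have "(a, p) \<in> pc (filiform k) j"
      using filiform_homogeneous[OF t(1), of f k] f_pc t(2) ap by simp
    then show ?thesis using j unfolding filiform_pc_iff ap by auto
  qed
  show ?thesis
  proof (intro exI[of _ "\<lambda>i u. snd (F u) i"] conjI allI ballI impI)
    fix i
    have "F (x + y) = (fst (F x) + fst (F y), \<lambda>i. snd (F x) i + snd (F y) i)"
      "F (cscale c x) = (c * fst (F x), \<lambda>i. c * snd (F x) i)" for x y c
      using F_add[of x y] F_scale[of c x] by (cases "F x"; cases "F y"; simp add: filiform_ops)+
    then show "cs.functional (\<lambda>u. snd (F u) i)"
      by (simp add: cs.functional_def)
  next
    fix v assume v: "v \<in> eigenspace (gr 1) J (- \<epsilon>)"
    show "snd (F v) 0 = \<eta> v"
      by (simp add: F_gen[OF sub[OF v]] f_eig'[OF v])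
    fix i j u assume "2 \<le> j" "u \<in> gr j \<times> gr j"
    then show "snd (F (complexify br v u)) i = 0"
      using fst0[of j u] by (cases "F u") (simp add: F_brk F_gen[OF sub[OF v]] f_eig'[OF v] filiform_ops)
  next
    fix i w u assume i: "i < k" and w: "w \<in> eigenspace (gr 1) J \<epsilon>"
    show "snd (F (complexify br w u)) (Suc i) = \<alpha> w * snd (F u) i"
      using i by (cases "F u") (simp add: F_brk F_gen[OF sub[OF w]] f_eig[OF w] filiform_ops)
  qed
qed

section \<open>The two identities and the vanishing of the complexified prolongation\<close>

lemma of_nat_add_numeral_nonzero:
  "(of_nat n :: complex) + numeral k \<noteq> 0" "1 + (of_nat n :: complex) \<noteq> 0"
proof -
  have "of_nat (n + numeral k) \<noteq> (0::complex)" "of_nat (1 + n) \<noteq> (0::complex)"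
    by (simp_all only: of_nat_eq_0_iff) simp_all
  then show "(of_nat n :: complex) + numeral k \<noteq> 0" "1 + (of_nat n :: complex) \<noteq> 0"
    by simp_all
qed

text \<open>
  The arithmetic behind the theorem. With \<open>\<mu> = n + 4\<close>, the first identity forces
  \<open>\<beta> = - (\<mu> - 1) l / 2\<close> or \<open>\<beta> = - (\<mu> - 2) l / 2\<close>, and the second one forces \<open>\<beta> = - l / (\<mu> - 2)\<close> or
  \<open>\<beta> = - 3 l / (2 (\<mu> - 2))\<close>. For \<open>l \<noteq> 0\<close> an equality between them would make a product of two integers,
  each at least \<open>2\<close>, equal to \<open>2\<close> or \<open>3\<close>. For \<open>\<mu> = 3\<close> there would be a common root \<open>\<beta> = - l\<close>.
\<close>

lemma no_common_root:
  fixes \<beta> l :: complex and n :: nat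
  assumes "l * ((of_nat n + 2) * \<beta> + l) + 2 * ((of_nat n + 2) * \<beta> + l)^2 = 0"
    and "2 * \<beta> + (of_nat n + 3) * l = 0 \<or> 2 * \<beta> + (of_nat n + 2) * l = 0"
  shows "l = 0"
proof -
  have fac: "((of_nat n + 2) * \<beta> + l) * (2 * (of_nat n + 2) * \<beta> + 3 * l) = 0"
    using assms(1) by (simp add: algebra_simps power2_eq_square)
  define N where "N = int n"
  have Nc: "of_nat n = (of_int N :: complex)" and N0: "N \<ge> 0"
    by (simp_all add: N_def)
  from assms(2) have "\<beta> = - (of_int N + 3) / 2 * l \<or> \<beta> = - (of_int N + 2) / 2 * l"
    unfolding Nc by (auto simp: field_simps eq_neg_iff_add_eq_0)
  then obtain m :: int where m: "\<beta> = - of_int m / 2 * l" "m = N + 3 \<or> m = N + 2"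
    by (metis of_int_add of_int_numeral)
  have "l * l * of_int ((2 - (N + 2) * m) * (3 - (N + 2) * m))
      = 2 * (((of_nat n + 2) * \<beta> + l) * (2 * (of_nat n + 2) * \<beta> + 3 * l))"
    unfolding Nc m(1) by (simp add: field_simps)
  then have "l * l * of_int ((2 - (N + 2) * m) * (3 - (N + 2) * m)) = 0"
    unfolding fac by simp
  moreover have "(N + 2) * m \<ge> 2 * 2"
    using N0 m(2) by (intro mult_mono) auto
  then have "(2 - (N + 2) * m) * (3 - (N + 2) * m) \<noteq> 0"
    by auto
  ultimately show ?thesis
    by (metis mult_eq_0_iff of_int_eq_0_iff)
qed

text \<open>
  The complexification of an element of \<open>\<gg>\<^sup>1\<close>, acting on \<open>\<mm>\<^sup>\<complex>\<close>; here \<open>Gr k\<close> is the part of degree \<open>-k\<close>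
  and the depth is \<open>n + 4\<close>. The element is split into \<open>z \<mapsto> P z \<in> \<gg>\<^sup>0\<close> on \<open>Gr 1\<close> and the map \<open>X\<close> on the
  lower degrees, each extended by zero, so that \<open>X_br\<close> expresses the defining equation of \<open>\<gg>\<^sup>1\<close> for all
  pairs at once. \<open>W0\<close> and \<open>W1\<close> are the two eigenspaces of \<open>J\<close>, in either order: the assumptions are
  symmetric in them. The last two assumptions are the coefficient functions of the homomorphisms into
  the filiform algebra.
\<close>

locale complex_prolongation = complex_space sc
  for sc :: "complex \<Rightarrow> 'c::ab_group_add \<Rightarrow> 'c" +
  fixes br :: "'c \<Rightarrow> 'c \<Rightarrow> 'c" and Gr :: "nat \<Rightarrow> 'c set"
    and W0 W1 :: "'c set" and P :: "'c \<Rightarrow> 'c \<Rightarrow> 'c" and X :: "'c \<Rightarrow> 'c" and n :: nat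
  assumes br_add_l: "br (x + y) z = br x z + br y z"
    and br_add_r: "br z (x + y) = br z x + br z y"
    and br_sc_l: "br (sc c x) y = sc c (br x y)"
    and br_sc_r: "br x (sc c y) = sc c (br x y)"
    and br_anti: "br y x = - br x y"
    and br_deriv: "br x (br y z) = br (br x y) z + br y (br x z)"
    and br_Gr: "x \<in> Gr i \<Longrightarrow> y \<in> Gr j \<Longrightarrow> br x y \<in> Gr (i + j)"
    and Gr_top: "Gr (n + 5) \<subseteq> {0}"
    and W0_Gr: "w \<in> W0 \<Longrightarrow> w \<in> Gr 1" and W1_Gr: "v \<in> W1 \<Longrightarrow> v \<in> Gr 1"
    and W0_add: "w \<in> W0 \<Longrightarrow> w' \<in> W0 \<Longrightarrow> w + w' \<in> W0"
    and W1_add: "v \<in> W1 \<Longrightarrow> v' \<in> W1 \<Longrightarrow> v + v' \<in> W1"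
    and W0_sc: "w \<in> W0 \<Longrightarrow> sc c w \<in> W0"
    and W1_sc: "v \<in> W1 \<Longrightarrow> sc c v \<in> W1"
    and W0_comm: "w \<in> W0 \<Longrightarrow> w' \<in> W0 \<Longrightarrow> br w w' = 0"
    and W1_comm: "v \<in> W1 \<Longrightarrow> v' \<in> W1 \<Longrightarrow> br v v' = 0"
    and P_add_l: "P (x + y) z = P x z + P y z"
    and P_sc_l: "P (sc c x) z = sc c (P x z)"
    and P_add_r: "z \<in> Gr 1 \<Longrightarrow> P z (x + y) = P z x + P z y"
    and P_sc_r: "z \<in> Gr 1 \<Longrightarrow> P z (sc c x) = sc c (P z x)"
    and P_br: "z \<in> Gr 1 \<Longrightarrow> P z (br x y) = br (P z x) y + br x (P z y)"
    and P_Gr: "z \<in> Gr 1 \<Longrightarrow> u \<in> Gr j \<Longrightarrow> P z u \<in> Gr j"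
    and P_W0: "z \<in> Gr 1 \<Longrightarrow> w \<in> W0 \<Longrightarrow> P z w \<in> W0"
    and P_W1: "z \<in> Gr 1 \<Longrightarrow> v \<in> W1 \<Longrightarrow> P z v \<in> W1"
    and P_low: "u \<in> Gr j \<Longrightarrow> 2 \<le> j \<Longrightarrow> P u x = 0"
    and X_add: "X (x + y) = X x + X y"
    and X_sc: "X (sc c x) = sc c (X x)"
    and X_deg1: "u \<in> Gr 1 \<Longrightarrow> X u = 0"
    and X_Gr: "u \<in> Gr (Suc (Suc j)) \<Longrightarrow> X u \<in> Gr (Suc j)"
    and X_br: "X (br y z) = br (X y) z + br y (X z) + P y z - P z y"
    and free0: "functional \<alpha> \<Longrightarrow> functional \<eta> \<Longrightarrow> \<exists>g. (\<forall>i. functional (g i)) \<and>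
        (\<forall>v\<in>W1. g 0 v = \<eta> v) \<and>
        (\<forall>i<n + 2. \<forall>w\<in>W0. \<forall>u. g (Suc i) (br w u) = \<alpha> w * g i u) \<and>
        (\<forall>i. \<forall>v\<in>W1. \<forall>j\<ge>2. \<forall>u\<in>Gr j. g i (br v u) = 0)"
    and free1: "functional \<alpha> \<Longrightarrow> functional \<eta> \<Longrightarrow> \<exists>g. (\<forall>i. functional (g i)) \<and>
        (\<forall>w\<in>W0. g 0 w = \<eta> w) \<and>
        (\<forall>i<n + 2. \<forall>v\<in>W1. \<forall>u. g (Suc i) (br v u) = \<alpha> v * g i u) \<and>
        (\<forall>i. \<forall>w\<in>W0. \<forall>j\<ge>2. \<forall>u\<in>Gr j. g i (br w u) = 0)"
begin

lemma swap: "complex_prolongation sc br Gr W1 W0 P X n"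
proof -
  note ax = complex_prolongation_axioms[unfolded complex_prolongation_def]
  show ?thesis
    unfolding complex_prolongation_def complex_prolongation_axioms_def
    using ax[unfolded complex_prolongation_axioms_def] by meson
qed

lemma br_zero_r: "br x 0 = 0"
  using br_add_r[of x 0 0] by simp

lemma br_zero_l: "br 0 x = 0"
  using br_add_l[of 0 0 x] by simp

lemma X_zero: "X 0 = 0"
  using X_add[of 0 0] by simp

lemma P_zero_l: "P 0 x = 0"
  using P_add_l[of 0 0 x] by simp

lemma P_zero_r: "z \<in> Gr 1 \<Longrightarrow> P z 0 = 0"
  using P_add_r[of z 0 0] by simp

lemma X_br1: "z \<in> Gr 1 \<Longrightarrow> u \<in> Gr j \<Longrightarrow> 2 \<le> j \<Longrightarrow> X (br z u) = P z u + br z (X u)"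
  by (simp add: X_br X_deg1 br_zero_l P_low)

lemma X_br11: "z \<in> Gr 1 \<Longrightarrow> u \<in> Gr 1 \<Longrightarrow> X (br z u) = P z u - P u z"
  by (simp add: X_br X_deg1 br_zero_l br_zero_r)

text \<open>
  Applying \<open>X\<close> to \<open>[w, w'] = 0\<close>.
\<close>

lemma P_sym:
  assumes "w \<in> W0" "w' \<in> W0"
  shows "P w w' = P w' w"
  using X_br11[OF W0_Gr[OF assms(1)] W0_Gr[OF assms(2)]] W0_comm[OF assms] X_zero by simp

definition ad_pow :: "'c \<Rightarrow> nat \<Rightarrow> 'c \<Rightarrow> 'c" where
  "ad_pow w k = (br w ^^ k)"

lemma ad_pow_simps [simp]: "ad_pow w 0 u = u" "ad_pow w (Suc k) u = br w (ad_pow w k u)"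
  by (simp_all add: ad_pow_def)

lemma ad_pow_Gr: "w \<in> Gr 1 \<Longrightarrow> v \<in> Gr 1 \<Longrightarrow> ad_pow w k v \<in> Gr (Suc k)"
  by (induction k) (use br_Gr[of w 1] in auto)

lemma br_commuting: "br x y = 0 \<Longrightarrow> br x (br y z) = br y (br x z)"
  by (simp add: br_deriv[of x y] br_zero_l)

text \<open>
  A Leibniz rule. The condition says that \<open>ad w\<close> and \<open>ad (P z w)\<close> commute, so the factor
  that the derivation \<open>P z\<close> has changed can be moved to the front.
\<close>

lemma P_ad_pow:
  assumes "z \<in> Gr 1" and "br w (P z w) = 0"
  shows "P z (ad_pow w k u) = ad_pow w k (P z u) + sc (of_nat k) (br (P z w) (ad_pow w (k - 1) u))"
proof (induction k)
  case (Suc k)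
  have "br w (br (P z w) (ad_pow w (k - 1) u)) = br (P z w) (ad_pow w k u)" if "k \<noteq> 0"
    using that br_commuting[OF assms(2)] by (cases k) auto
  then have "sc (of_nat k) (br w (br (P z w) (ad_pow w (k - 1) u)))
      = sc (of_nat k) (br (P z w) (ad_pow w k u))"
    by (cases "k = 0") auto
  then show ?case
    using Suc by (simp add: P_br[OF assms(1)] br_add_r br_sc_r algebra_simps scale_left_distrib)
qed auto

text \<open>
  Moving \<open>X\<close> through \<open>ad w \<dots> ad w\<close>, each factor produces one \<open>P w\<close>, and each \<open>P w\<close> then acts as a
  derivation on the factors behind it; hence the coefficients \<open>m\<close> and \<open>m (m - 1) / 2\<close> with \<open>m = j + 2\<close>.
  The possible third term \<open>ad w (P v w)\<close> vanishes, because \<open>W0\<close> is commutative.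
\<close>

lemma X_ad_pow:
  assumes w: "w \<in> W0" and v: "v \<in> W1"
  shows "X (ad_pow w (Suc (Suc j)) v)
    = sc (of_nat (j + 2)) (ad_pow w (Suc j) (P w v))
      + sc (of_nat ((j + 2) * (j + 1)) / 2) (br (P w w) (ad_pow w j v))"
proof (induction j)
  case 0
  have "X (br w (br w v)) = P w (br w v) + br w (X (br w v))"
    using br_Gr[OF W0_Gr[OF w] W1_Gr[OF v]] by (intro X_br1[OF W0_Gr[OF w]]) (auto simp: numeral_2_eq_2)
  also have "X (br w v) = P w v + sc (- 1) (P v w)"
    by (simp add: X_br11[OF W0_Gr[OF w] W1_Gr[OF v]])
  also have "br w (P w v + sc (- 1) (P v w)) = br w (P w v)"
    by (simp only: br_add_r br_sc_r W0_comm[OF w P_W0[OF W1_Gr[OF v] w]]) simp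
  also have "P w (br w v) = br (P w w) v + br w (P w v)"
    by (rule P_br[OF W0_Gr[OF w]])
  finally show ?case
    using scale_left_distrib[of 1 1 "br w (P w v)"] by (simp add: algebra_simps)
next
  case (Suc j)
  let ?a = "P w w"
  have wa: "br w ?a = 0"
    using W0_comm[OF w P_W0[OF W0_Gr[OF w] w]] .
  have "X (br w (ad_pow w (Suc (Suc j)) v))
      = P w (ad_pow w (Suc (Suc j)) v) + br w (X (ad_pow w (Suc (Suc j)) v))"
    using ad_pow_Gr[OF W0_Gr[OF w] W1_Gr[OF v], of "Suc (Suc j)"]
    by (intro X_br1[OF W0_Gr[OF w]]) auto
  also have "P w (ad_pow w (Suc (Suc j)) v) = ad_pow w (Suc (Suc j)) (P w v)
      + sc (of_nat (Suc (Suc j))) (br ?a (ad_pow w (Suc j) v))"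
    using P_ad_pow[OF W0_Gr[OF w] wa, of "Suc (Suc j)" v] by simp
  also have "br w (X (ad_pow w (Suc (Suc j)) v)) = sc (of_nat (j + 2)) (ad_pow w (Suc (Suc j)) (P w v))
      + sc (of_nat ((j + 2) * (j + 1)) / 2) (br ?a (ad_pow w (Suc j) v))"
    unfolding Suc.IH br_add_r br_sc_r by (simp add: br_commuting[OF wa])
  finally have eq: "X (ad_pow w (Suc (Suc (Suc j))) v) =
      (ad_pow w (Suc (Suc j)) (P w v) + sc (of_nat (j + 2)) (ad_pow w (Suc (Suc j)) (P w v)))
      + (sc (of_nat (Suc (Suc j))) (br ?a (ad_pow w (Suc j) v))
      + sc (of_nat ((j + 2) * (j + 1)) / 2) (br ?a (ad_pow w (Suc j) v)))"
    by (simp only: ad_pow_simps add.assoc add.left_commute)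
  have 1: "u + sc (of_nat (j + 2)) u = sc (of_nat (Suc j + 2)) u" for u
    using scale_left_distrib[of 1 "of_nat (j + 2)" u] by simp
  have 2: "sc (of_nat (Suc (Suc j))) u + sc (of_nat ((j + 2) * (j + 1)) / 2) u
      = sc (of_nat ((Suc j + 2) * (Suc j + 1)) / 2) u" for u
    by (simp only: scale_left_distrib[symmetric]) (rule arg_cong[of _ _ "\<lambda>c. sc c u"], simp add: field_simps)
  show ?case
    by (simp only: eq 1 2)
qed

text \<open>
  The string \<open>ad w \<dots> ad w v\<close> with \<open>n + 4\<close> factors lies in degree \<open>-(n+5)\<close>, so it vanishes, and so does
  the result of applying \<open>X\<close> to it twice. The latter lies in degree \<open>-(n+3)\<close>, where the coefficient
  function \<open>g (n + 2)\<close> turns it into a polynomial in \<open>s = \<alpha> w\<close>. A common nonzero factor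
  \<open>(n + 4) (n + 3) / 2\<close> has been removed.
\<close>

lemma X_squared_pure_string:
  assumes w: "w \<in> W0" and v: "v \<in> W1" and \<alpha>: "functional \<alpha>" and \<eta>: "functional \<eta>"
  defines "a \<equiv> P w w" and "s \<equiv> \<alpha> w" and "N \<equiv> (of_nat n :: complex)"
  shows "s ^ n * (2 * s^2 * \<eta> (P w (P w v)) + 2 * (N + 2) * s * \<alpha> a * \<eta> (P w v) + s^2 * \<eta> (P a v)
    + (N + 2) * s * \<alpha> (P a w) * \<eta> v + (N + 2) * (N + 1) / 2 * \<alpha> a ^ 2 * \<eta> v) = 0"
proof -
  have aW: "a \<in> W0" unfolding a_def by (intro P_W0 W0_Gr w)
  have w1: "w \<in> Gr 1" and a1: "a \<in> Gr 1" and v1: "v \<in> Gr 1"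
    using w aW v W0_Gr W1_Gr by auto
  have bW: "P w v \<in> W1" and abW: "P a v \<in> W1" and bbW: "P w (P w v) \<in> W1"
    using P_W1 w1 a1 v by auto
  have PaW: "P a w \<in> W0" by (intro P_W0 a1 w)
  obtain g where g: "\<And>i. functional (g i)" "\<And>v. v \<in> W1 \<Longrightarrow> g 0 v = \<eta> v"
    and gS: "\<And>i w u. i < n + 2 \<Longrightarrow> w \<in> W0 \<Longrightarrow> g (Suc i) (br w u) = \<alpha> w * g i u"
    using free0[OF \<alpha> \<eta>] by metis
  have gl: "g i (x + y) = g i x + g i y" "g i (sc c x) = c * g i x" for i x y c
    using g(1)[of i] by (auto simp: functional_def)
  have gpow: "i \<le> n + 2 \<Longrightarrow> u \<in> W1 \<Longrightarrow> g i (ad_pow w i u) = s ^ i * \<eta> u" for i u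
    by (induction i) (auto simp: g(2) gS w s_def)
  define k where "k = Suc (Suc n)"
  have "Suc (Suc (Suc k)) = n + 5" by (simp add: k_def)
  then have "ad_pow w (Suc (Suc k)) v \<in> Gr (n + 5)"
    using ad_pow_Gr[OF w1 v1, of "Suc (Suc k)"] by (simp only:)
  then have "ad_pow w (Suc (Suc k)) v = 0"
    using Gr_top by blast
  then have "0 = X (X (ad_pow w (Suc (Suc k)) v))"
    by (simp only: X_zero)
  also have "\<dots> = sc (of_nat (k + 2)) (X (ad_pow w (Suc k) (P w v)))
      + sc (of_nat ((k + 2) * (k + 1)) / 2) (X (br a (ad_pow w k v)))"
    by (simp only: X_ad_pow[OF w v] X_add X_sc a_def)
  also have "X (br a (ad_pow w k v)) = P a (ad_pow w k v) + br a (X (ad_pow w k v))"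
    using ad_pow_Gr[OF w1 v1, of k] by (intro X_br1[OF a1]) (auto simp: k_def)
  also have "P a (ad_pow w k v) = ad_pow w k (P a v) + sc (of_nat k) (br (P a w) (ad_pow w (Suc n) v))"
    using P_ad_pow[OF a1 W0_comm[OF w PaW], of k v] by (simp add: k_def)
  also have "X (ad_pow w k v) = sc (of_nat (n + 2)) (ad_pow w (Suc n) (P w v))
      + sc (of_nat ((n + 2) * (n + 1)) / 2) (br a (ad_pow w n v))"
    unfolding k_def by (simp only: X_ad_pow[OF w v] a_def)
  also have "X (ad_pow w (Suc k) (P w v)) = sc (of_nat (n + 3)) (ad_pow w k (P w (P w v)))
      + sc (of_nat ((n + 3) * (n + 2)) / 2) (br a (ad_pow w (Suc n) (P w v)))"
    using X_ad_pow[OF w bW, of "Suc n"] by (simp add: k_def a_def eval_nat_numeral)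
  finally have "0 = g k (sc (of_nat (k + 2)) (sc (of_nat (n + 3)) (ad_pow w k (P w (P w v)))
      + sc (of_nat ((n + 3) * (n + 2)) / 2) (br a (ad_pow w (Suc n) (P w v))))
      + sc (of_nat ((k + 2) * (k + 1)) / 2) (ad_pow w k (P a v) + sc (of_nat k) (br (P a w) (ad_pow w (Suc n) v))
      + br a (sc (of_nat (n + 2)) (ad_pow w (Suc n) (P w v))
      + sc (of_nat ((n + 2) * (n + 1)) / 2) (br a (ad_pow w n v)))))"
    using functional_zero[OF g(1)[of k]] by simp
  also have "\<dots> = (N + 4) * ((N + 3) * (s ^ k * \<eta> (P w (P w v)))
      + (N + 3) * (N + 2) / 2 * (\<alpha> a * (s ^ Suc n * \<eta> (P w v))))
      + (N + 4) * (N + 3) / 2 * (s ^ k * \<eta> (P a v) + (N + 2) * (\<alpha> (P a w) * (s ^ Suc n * \<eta> v))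
      + ((N + 2) * (\<alpha> a * (s ^ Suc n * \<eta> (P w v)))
      + (N + 2) * (N + 1) / 2 * (\<alpha> a * (\<alpha> a * (s ^ n * \<eta> v)))))"
    by (simp only: gl br_add_r br_sc_r k_def gS[OF _ aW] gS[OF _ PaW] gpow bW v abW bbW)
      (simp add: gS[OF _ aW] gS[OF _ PaW] gpow bW v abW bbW N_def gl k_def[symmetric] del: ad_pow_simps, simp add: k_def algebra_simps)
  also have "\<dots> = (N + 4) * (N + 3) / 2 * (s ^ n * (2 * s^2 * \<eta> (P w (P w v)) + 2 * (N + 2) * s * \<alpha> a * \<eta> (P w v)
    + s^2 * \<eta> (P a v) + (N + 2) * s * \<alpha> (P a w) * \<eta> v + (N + 2) * (N + 1) / 2 * \<alpha> a ^ 2 * \<eta> v))"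
    by (simp add: k_def field_simps power2_eq_square)
  finally have "(N + 4) * (N + 3) / 2 * (s ^ n * (2 * s^2 * \<eta> (P w (P w v)) + 2 * (N + 2) * s * \<alpha> a * \<eta> (P w v)
    + s^2 * \<eta> (P a v) + (N + 2) * s * \<alpha> (P a w) * \<eta> v + (N + 2) * (N + 1) / 2 * \<alpha> a ^ 2 * \<eta> v)) = 0"
    by simp
  moreover have "(N + 4) * (N + 3) / 2 \<noteq> 0"
    by (simp add: N_def of_nat_add_numeral_nonzero)
  ultimately show ?thesis by (simp only: mult_eq_0_iff) simp
qed

text \<open>
  The same argument for \<open>ad w ad w Z\<close>, where \<open>Z = ad v \<dots> ad v w'\<close> with \<open>n + 2\<close> factors. With the
  roles of \<open>W0\<close> and \<open>W1\<close> interchanged, the coefficient functions kill all brackets \<open>[W0, Gr j]\<close> with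
  \<open>j \<ge> 2\<close>. The only terms left are those in which \<open>X\<close> has absorbed both outer factors, namely
  \<open>P (P w w) Z + 2 P w (P w Z)\<close>, and they are evaluated by the Leibniz rule.
\<close>

lemma X_squared_mixed_string:
  assumes w: "w \<in> W0" and w': "w' \<in> W0" and v: "v \<in> W1" and \<alpha>: "functional \<alpha>" and \<eta>: "functional \<eta>"
  defines "a \<equiv> P w w" and "s \<equiv> \<alpha> v" and "k \<equiv> (of_nat n + 2 :: complex)"
  shows "s ^ n * (k * s * \<alpha> (P a v) * \<eta> w' + s^2 * \<eta> (P a w')
     + 2 * (k * (k - 1) * \<alpha> (P w v) ^ 2 * \<eta> w' + k * s * \<alpha> (P w (P w v)) * \<eta> w'
       + 2 * k * s * \<alpha> (P w v) * \<eta> (P w w') + s^2 * \<eta> (P w (P w w')))) = 0"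
proof -
  have aW: "a \<in> W0" unfolding a_def by (intro P_W0 W0_Gr w)
  have w1: "w \<in> Gr 1" and a1: "a \<in> Gr 1" and v1: "v \<in> Gr 1" and w'1: "w' \<in> Gr 1"
    using w w' aW v W0_Gr W1_Gr by auto
  have bW: "P w v \<in> W1" and abW: "P a v \<in> W1" and bbW: "P w (P w v) \<in> W1"
    using P_W1 w1 a1 v by auto
  obtain g where g: "\<And>i. functional (g i)" "\<And>w. w \<in> W0 \<Longrightarrow> g 0 w = \<eta> w"
    and gS: "\<And>i v u. i < n + 2 \<Longrightarrow> v \<in> W1 \<Longrightarrow> g (Suc i) (br v u) = \<alpha> v * g i u"
    and gW: "\<And>i w u j. w \<in> W0 \<Longrightarrow> 2 \<le> j \<Longrightarrow> u \<in> Gr j \<Longrightarrow> g i (br w u) = 0"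
    using free1[OF \<alpha> \<eta>] by metis
  have gl: "g i (x + y) = g i x + g i y" "g i (sc c x) = c * g i x" for i x y c
    using g(1)[of i] by (auto simp: functional_def)
  have gpow: "i \<le> n + 2 \<Longrightarrow> u \<in> W0 \<Longrightarrow> g i (ad_pow v i u) = s ^ i * \<eta> u" for i u
    by (induction i) (auto simp: g(2) gS v s_def)
  \<comment> \<open>\<open>Z\<close> lies in degree \<open>-(n+3)\<close>, the degree in which \<open>g m\<close> will be applied\<close>
  define m where "m = Suc (Suc n)"
  define Z where "Z = ad_pow v m w'"
  have Z: "Z \<in> Gr (n + 3)"
    using ad_pow_Gr[OF v1 w'1, of m] by (simp add: Z_def m_def eval_nat_numeral)
  have XZ: "X Z \<in> Gr (n + 2)"
    using X_Gr[of Z "Suc n"] Z by (simp add: eval_nat_numeral)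
  have PZ: "P w Z \<in> Gr (n + 3)" by (rule P_Gr[OF w1 Z])
  have XPZ: "X (P w Z) \<in> Gr (n + 2)"
    using X_Gr[of "P w Z" "Suc n"] PZ by (simp add: eval_nat_numeral)
  have wZ: "br w Z \<in> Gr (n + 4)"
    using br_Gr[OF w1 Z] by (simp add: eval_nat_numeral)
  have wXZ: "br w (X Z) \<in> Gr (n + 3)"
    using br_Gr[OF w1 XZ] by (simp add: eval_nat_numeral)
  have XwXZ: "X (br w (X Z)) \<in> Gr (n + 2)"
    using X_Gr[of "br w (X Z)" "Suc n"] wXZ by (simp add: eval_nat_numeral)
  have PXZ: "P w (X Z) \<in> Gr (n + 2)" by (rule P_Gr[OF w1 XZ])
  have XwZ: "X (br w Z) = P w Z + br w (X Z)"
    by (rule X_br1[OF w1 Z]) simp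
  have "br w (br w Z) \<in> Gr (n + 5)"
    using br_Gr[OF w1 wZ] by (simp add: eval_nat_numeral)
  then have "0 = X (br w (br w Z))"
    using Gr_top X_zero by auto
  also have "\<dots> = P w (br w Z) + br w (X (br w Z))"
    by (rule X_br1[OF w1 wZ]) simp
  also have "\<dots> = br a Z + br w (P w Z) + (br w (P w Z) + br w (br w (X Z)))"
    by (simp only: XwZ br_add_r P_br[OF w1] a_def)
  finally have "0 = X (br a Z + br w (P w Z) + (br w (P w Z) + br w (br w (X Z))))"
    using X_zero by simp
  also have "\<dots> = P a Z + br a (X Z) + (P w (P w Z) + br w (X (P w Z)))
      + (P w (P w Z) + br w (X (P w Z)) + (br a (X Z) + br w (P w (X Z)) + br w (X (br w (X Z)))))"
    unfolding X_add X_br1[OF a1 Z, simplified] X_br1[OF w1 PZ, simplified] X_br1[OF w1 wXZ, simplified]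
      P_br[OF w1] a_def[symmetric]
    by (simp only: add.assoc)
  finally have "0 = g m \<dots>"
    using functional_zero[OF g(1)[of m]] by simp
  also have "\<dots> = g m (P a Z) + 2 * g m (P w (P w Z))"
    by (simp add: gl gW[OF aW _ XZ] gW[OF w _ XPZ] gW[OF w _ PXZ] gW[OF w _ XwXZ])
  finally have main: "g m (P a Z) + 2 * g m (P w (P w Z)) = 0" by simp
  have PZ_eq: "P z Z = ad_pow v m (P z w') + sc (of_nat m) (br (P z v) (ad_pow v (Suc n) w'))"
    if "z \<in> Gr 1" for z
    using P_ad_pow[OF that W1_comm[OF v P_W1[OF that v]], of m w'] by (simp add: Z_def m_def)
  have Pa: "g m (P a Z) = s ^ m * \<eta> (P a w') + of_nat m * (\<alpha> (P a v) * (s ^ Suc n * \<eta> w'))"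
    unfolding PZ_eq[OF a1] gl using gS[OF _ abW] gpow w' P_W0[OF a1 w'] by (simp add: m_def del: ad_pow_simps)
  have vb: "br v (P w v) = 0" by (rule W1_comm[OF v bW])
  have pn: "P w (ad_pow v j u) = ad_pow v j (P w u) + sc (of_nat j) (br (P w v) (ad_pow v (j - 1) u))" for j u
    by (rule P_ad_pow[OF w1 vb])
  have "P w (P w Z) = ad_pow v m (P w (P w w')) + sc (of_nat m) (br (P w v) (ad_pow v (Suc n) (P w w')))
     + sc (of_nat m) (br (P w (P w v)) (ad_pow v (Suc n) w')
       + br (P w v) (ad_pow v (Suc n) (P w w') + sc (of_nat (Suc n)) (br (P w v) (ad_pow v n w'))))"
    unfolding PZ_eq[OF w1] P_add_r[OF w1] P_sc_r[OF w1] P_br[OF w1] pn by (simp add: m_def del: ad_pow_simps)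
  then have PP: "g m (P w (P w Z)) = s ^ m * \<eta> (P w (P w w')) + of_nat m * (\<alpha> (P w v) * (s ^ Suc n * \<eta> (P w w')))
     + of_nat m * (\<alpha> (P w (P w v)) * (s ^ Suc n * \<eta> w')
       + (\<alpha> (P w v) * (s ^ Suc n * \<eta> (P w w')) + of_nat (Suc n) * (\<alpha> (P w v) * (\<alpha> (P w v) * (s ^ n * \<eta> w')))))"
    using gS[OF _ bW] gS[OF _ bbW] gpow w' P_W0[OF w1 w'] P_W0[OF w1 P_W0[OF w1 w']]
    by (simp add: m_def gl br_add_r br_sc_r del: ad_pow_simps)
  show ?thesis
    using main unfolding Pa PP by (simp add: m_def k_def field_simps power2_eq_square)
qed


text \<open>
  If \<open>a = P w w\<close> and \<open>w\<close> were linearly independent, the values \<open>\<alpha> w = s\<close> and \<open>\<alpha> a = 1\<close> could be prescribed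
  together. Taking \<open>\<alpha>\<close> affine in \<open>s\<close>, the first identity is \<open>s\<^sup>n\<close> times a quadratic polynomial in \<open>s\<close>,
  whose constant term comes from \<open>(\<alpha> a)\<^sup>2\<close> and is not zero.
\<close>

lemma bracket_square_proportional:
  assumes w: "w \<in> W0" and w0: "w \<noteq> 0" and v: "v \<in> W1" and v0: "v \<noteq> 0"
  obtains l where "P w w = sc l w"
proof (rule ccontr)
  assume "\<not> thesis"
  then have ni: "P w w \<noteq> sc c w" for c using that by blast
  obtain \<eta> where \<eta>: "functional \<eta>" "\<eta> v = 1" by (rule functional_separating[OF v0])
  obtain \<alpha> where \<alpha>: "functional \<alpha>" "\<alpha> w = 1" "\<alpha> (P w w) = 0"
    by (rule functional_separating2[OF w0 ni])
  obtain \<beta> where \<beta>: "functional \<beta>" "\<beta> w = 0" "\<beta> (P w w) = 1"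
    by (rule functional_separating2[OF w0 ni])
  define p q r :: complex where
    "p = 2 * \<eta> (P w (P w v)) + \<eta> (P (P w w) v) + (of_nat n + 2) * \<alpha> (P (P w w) w)"
    and "q = 2 * (of_nat n + 2) * \<eta> (P w v) + (of_nat n + 2) * \<beta> (P (P w w) w)"
    and "r = (of_nat n + 2) * (of_nat n + 1) / 2"
  have "p * s^2 + q * s + r = 0" if "s \<noteq> 0" for s
  proof -
    have "functional (\<lambda>x. s * \<alpha> x + \<beta> x)"
      using \<alpha>(1) \<beta>(1) by (simp add: functional_def algebra_simps)
    from X_squared_pure_string[OF w v this \<eta>(1)] have "s ^ n * (p * s^2 + q * s + r) = 0"
      by (simp add: \<alpha> \<beta> \<eta> p_def q_def r_def algebra_simps power2_eq_square)
    then show ?thesis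
      using that by simp
  qed
  \<comment> \<open>a quadratic polynomial with the three zeros \<open>1\<close>, \<open>-1\<close> and \<open>2\<close>\<close>
  from this[of 1] this[of "- 1"] this[of 2] have "r = 0"
    by simp algebra
  moreover have "r \<noteq> 0"
    by (simp add: r_def of_nat_add_numeral_nonzero add.commute[of _ 1])
  ultimately show False by simp
qed

text \<open>
  With \<open>P w w = l w\<close> the first identity becomes the factorized quadratic equation
  \<open>(2 B + (n + 3) l) (2 B + (n + 2) l) = 0\<close> for \<open>B = P w\<close> on \<open>W1\<close>. So \<open>B\<close> has an eigenvector
  \<open>v'\<close> with one of two explicit eigenvalues, and the second identity for this eigenvector leaves only
  \<open>l = 0\<close>.
\<close>

lemma bracket_square_zero:
  assumes w: "w \<in> W0" and w0: "w \<noteq> 0" and v: "v \<in> W1" and v0: "v \<noteq> 0"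
  shows "P w w = 0"
proof -
  obtain l where l: "P w w = sc l w"
    by (rule bracket_square_proportional[OF assms])
  have w1: "w \<in> Gr 1" by (rule W0_Gr[OF w])
  define N where "N = (of_nat n :: complex)"
  \<comment> \<open>twice the first identity, for a functional with \<open>\<alpha> w = 1\<close>\<close>
  have quad: "\<eta> (sc 4 (P w (P w v')) + sc (2 * (2 * N + 5) * l) (P w v')
      + sc ((N + 2) * (N + 3) * l^2) v') = 0"
    if \<eta>: "functional \<eta>" and v': "v' \<in> W1" for \<eta> v'
  proof -
    obtain \<alpha> where \<alpha>: "functional \<alpha>" "\<alpha> w = 1" by (rule functional_separating[OF w0])
    have e: "\<eta> (x + y) = \<eta> x + \<eta> y" "\<eta> (sc c x) = c * \<eta> x" "\<alpha> (sc c x) = c * \<alpha> x" for x y c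
      using \<eta> \<alpha>(1) by (auto simp: functional_def)
    show ?thesis
      using X_squared_pure_string[OF w v' \<alpha>(1) \<eta>]
      by (simp add: \<alpha> e l P_sc_l N_def[symmetric]) (simp add: field_simps power2_eq_square)
  qed
  have root: "sc 4 (P w (P w v)) + sc (2 * (2 * N + 5) * l) (P w v) + sc ((N + 2) * (N + 3) * l^2) v = 0"
    using quad[OF _ v] functional_separating by (metis zero_neq_one)
  \<comment> \<open>either \<open>u = 0\<close>, and \<open>v\<close> is an eigenvector of \<open>P w\<close>, or \<open>u\<close> itself is one\<close>
  define u where "u = sc 2 (P w v) + sc ((N + 2) * l) v"
  have Pu: "sc 2 (P w u) + sc ((N + 3) * l) u = 0"
  proof -
    have coeffs: "2 * (2 * N + 5) * l = 2 * ((N + 2) * l) + (N + 3) * l * 2"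
      "(N + 2) * (N + 3) * l^2 = (N + 3) * l * ((N + 2) * l)"
      by (simp_all add: algebra_simps power2_eq_square)
    have "sc 2 (P w u) + sc ((N + 3) * l) u
        = sc 4 (P w (P w v)) + sc (2 * (2 * N + 5) * l) (P w v) + sc ((N + 2) * (N + 3) * l^2) v"
      unfolding u_def P_add_r[OF w1] P_sc_r[OF w1] coeffs scale_left_distrib scale_right_distrib
      by (simp add: add.assoc add.left_commute)
    then show ?thesis using root by simp
  qed
  have "\<exists>v'\<in>W1. v' \<noteq> 0 \<and> (\<exists>\<beta>. P w v' = sc \<beta> v' \<and>
      (2 * \<beta> + (of_nat n + 3) * l = 0 \<or> 2 * \<beta> + (of_nat n + 2) * l = 0))"
  proof -
    have half: "x = sc (- c / 2) y" if "sc 2 x + sc c y = 0" for x y c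
    proof -
      have "sc (1/2) (sc 2 x + sc c y) = 0" using that by simp
      then show ?thesis by (simp add: scale_right_distrib eq_neg_iff_add_eq_0)
    qed
    show ?thesis
    proof (cases "u = 0")
      case True
      then have "P w v = sc (- ((N + 2) * l) / 2) v"
        using half u_def by simp
      then show ?thesis using v v0 
        by (intro bexI[of _ v] conjI exI[of _ "- ((N + 2) * l) / 2"]) (auto simp: N_def)
    next
      case False
      have "u \<in> W1" unfolding u_def by (intro W1_add W1_sc P_W1 w1 v)
      moreover have "P w u = sc (- ((N + 3) * l) / 2) u" using half[OF Pu] .
      ultimately show ?thesis using False 
        by (intro bexI[of _ u] conjI exI[of _ "- ((N + 3) * l) / 2"]) (auto simp: N_def)
    qed
  qed
  then obtain v' \<beta> where v': "v' \<in> W1" "v' \<noteq> 0" "P w v' = sc \<beta> v'"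
    and \<beta>: "2 * \<beta> + (of_nat n + 3) * l = 0 \<or> 2 * \<beta> + (of_nat n + 2) * l = 0" by blast
  obtain \<alpha> where \<alpha>: "functional \<alpha>" "\<alpha> v' = 1" by (rule functional_separating[OF v'(2)])
  obtain \<eta> where \<eta>: "functional \<eta>" "\<eta> w = 1" by (rule functional_separating[OF w0])
  have e: "\<eta> (sc c x) = c * \<eta> x" "\<alpha> (sc c x) = c * \<alpha> x" for x c
    using \<eta> \<alpha>(1) by (auto simp: functional_def)
  have "l * ((of_nat n + 2) * \<beta> + l) + 2 * ((of_nat n + 2) * \<beta> + l)^2 = 0"
    using X_squared_mixed_string[OF w w v'(1) \<alpha>(1) \<eta>(1)]
    by (simp add: \<alpha> \<eta> e l P_sc_l P_sc_r[OF w1] v'(3)) (simp add: algebra_simps power2_eq_square)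
  then have "l = 0" using no_common_root \<beta> by blast
  then show ?thesis using l by simp
qed

text \<open>
  Polarization of the previous lemma.
\<close>

lemma P_vanishes_on_W0:
  assumes "v \<in> W1" "v \<noteq> 0" and w: "w \<in> W0" "w' \<in> W0"
  shows "P w w' = 0"
proof -
  have sq: "P u u = 0" if "u \<in> W0" for u
    using bracket_square_zero[OF that _ assms(1,2)] P_zero_l by (cases "u = 0") auto
  have "P (w + w') (w + w') = P w w' + P w w'"
    using w by (simp add: P_add_l P_add_r W0_Gr[simplified] sq P_sym)
  then have "sc 2 (P w w') = 0"
    using sq[OF W0_add[OF w]] scale_left_distrib[of 1 1 "P w w'"] by simp
  then show ?thesis by simp
qed

text \<open>
  Now that \<open>P w\<close> is zero on \<open>W0\<close>, the first identity says that \<open>P w\<close> squares to zero on \<open>W1\<close>, and the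
  second one that \<open>\<alpha>(u)\<^sup>n \<alpha>(P w u)\<^sup>2 = 0\<close> for all \<open>\<alpha>\<close> and all \<open>u \<in> W1\<close>. Both \<open>u = v\<close> and
  \<open>u = v + P w v\<close> have the same image \<open>P w v\<close>, and a functional with \<open>\<alpha>(P w v) = 1\<close> cannot vanish on both.
\<close>

lemma P_vanishes_on_W1:
  assumes w: "w \<in> W0" and v: "v \<in> W1"
  shows "P w v = 0"
proof (rule ccontr)
  assume ne: "P w v \<noteq> 0"
  have w1: "w \<in> Gr 1" by (rule W0_Gr[OF w])
  have w0: "w \<noteq> 0" using ne P_zero_l by auto
  have P0: "P w x = 0" if "x \<in> W0" for x
    by (rule P_vanishes_on_W0[OF P_W1[OF w1 v] ne w that])
  obtain \<eta> where \<eta>: "functional \<eta>" "\<eta> w = 1" by (rule functional_separating[OF w0])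
  have BB: "P w (P w u) = 0" if u: "u \<in> W1" for u
  proof (rule ccontr)
    assume "P w (P w u) \<noteq> 0"
    then obtain \<theta> where \<theta>: "functional \<theta>" "\<theta> (P w (P w u)) = 1" by (rule functional_separating)
    from X_squared_pure_string[OF w u \<eta>(1) \<theta>(1)] show False
      by (simp add: \<eta> \<theta> P0[OF w] P_zero_l functional_zero)
  qed
  obtain \<alpha> where \<alpha>: "functional \<alpha>" "\<alpha> (P w v) = 1" by (rule functional_separating[OF ne])
  have key: "\<alpha> u ^ n * \<alpha> (P w u) ^ 2 = 0" if u: "u \<in> W1" for u
  proof -
    show ?thesis
      using X_squared_mixed_string[OF w w u \<alpha>(1) \<eta>(1)]
      by (simp add: of_nat_add_numeral_nonzero \<alpha> \<eta> P0[OF w] P_zero_l P_zero_r[OF w1] BB[OF u] functional_zero[OF \<eta>(1)] functional_zero[OF \<alpha>(1)])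
  qed
  have "P w (v + P w v) = P w v"
    by (simp add: P_add_r[OF w1] BB[OF v])
  moreover have "\<alpha> (v + P w v) = \<alpha> v + 1"
    using \<alpha> by (simp add: functional_def)
  ultimately have "\<alpha> v = 0" "\<alpha> v + 1 = 0"
    using key[OF v] key[OF W1_add[OF v P_W1[OF w1 v]]] by (simp_all add: \<alpha>)
  then show False by simp
qed

lemma P_vanishes:
  assumes w: "w \<in> W0" "w \<noteq> 0" and v: "v \<in> W1" "v \<noteq> 0"
    and "x \<in> W0 \<union> W1" "y \<in> W0 \<union> W1"
  shows "P x y = 0"
proof -
  interpret s: complex_prolongation sc br Gr W1 W0 P X n by (rule swap)
  show ?thesis
    using assms P_vanishes_on_W0[OF v] P_vanishes_on_W1
      s.P_vanishes_on_W0[OF w] s.P_vanishes_on_W1 by blast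
qed

end

section \<open>Elements of degree one of the prolongation\<close>

lemma fundamental_algebraD:
  assumes "fundamental_algebra \<mu> br gr"
  shows "bilinear br" "br x x = 0" "br x (br y z) + br y (br z x) + br z (br x y) = 0"
    "subspace (gr k)" "k > \<mu> \<Longrightarrow> gr k = {0}" "1 \<le> \<mu>"
    "\<exists>f. (\<forall>k. f k \<in> gr k) \<and> x = (\<Sum>k=1..\<mu>. f k)"
    "x \<in> gr i \<Longrightarrow> y \<in> gr j \<Longrightarrow> br x y \<in> gr (i + j)"
    "i \<ge> 1 \<Longrightarrow> span {br x y | x y. x \<in> gr i \<and> y \<in> gr 1} = gr (i + 1)"
proof -
  note a = assms[unfolded fundamental_algebra_def lie_bracket_axioms_def]
  show "bilinear br" using a by (elim conjE)
  have "\<forall>x. br x x = 0" using a by (elim conjE)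
  then show "br x x = 0" ..
  have "\<forall>x y z. br x (br y z) + br y (br z x) + br z (br x y) = 0" using a by (elim conjE)
  then show "br x (br y z) + br y (br z x) + br z (br x y) = 0" by blast
  have "\<forall>k. subspace (gr k)" using a by (elim conjE)
  then show "subspace (gr k)" ..
  have "\<forall>k. k = 0 \<or> k > \<mu> \<longrightarrow> gr k = {0}" using a by (elim conjE)
  then show "k > \<mu> \<Longrightarrow> gr k = {0}" by simp
  show "1 \<le> \<mu>" using a by (elim conjE)
  have "\<forall>x. \<exists>!f. (\<forall>k. f k \<in> gr k) \<and> x = (\<Sum>k=1..\<mu>. f k)" using a by (elim conjE)
  then show "\<exists>f. (\<forall>k. f k \<in> gr k) \<and> x = (\<Sum>k=1..\<mu>. f k)" by (blast dest: spec[of _ x])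
  have "\<forall>i j. \<forall>x\<in>gr i. \<forall>y\<in>gr j. br x y \<in> gr (i + j)" using a by (elim conjE)
  then show "x \<in> gr i \<Longrightarrow> y \<in> gr j \<Longrightarrow> br x y \<in> gr (i + j)" by blast
  have "\<forall>i\<ge>1. span {br x y | x y. x \<in> gr i \<and> y \<in> gr 1} = gr (i + 1)" using a by (elim conjE)
  then show "i \<ge> 1 \<Longrightarrow> span {br x y | x y. x \<in> gr i \<and> y \<in> gr 1} = gr (i + 1)" by blast
qed

text \<open>
  An element of \<open>\<gg>\<^sup>1\<close> in components: \<open>A y \<in> \<gg>\<^sup>0\<close> is its value at \<open>y \<in> \<mm>\<^sup>-\<^sup>1\<close>, and \<open>X1\<close> is its restriction to
  the lower degrees with values in \<open>\<mm>\<close>. Both are extended by zero to all of \<open>\<mm>\<close>.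
\<close>

locale degree_one_prolongation =
  fixes \<mu> :: nat and br :: "'m::real_vector \<Rightarrow> 'm \<Rightarrow> 'm" and gr :: "nat \<Rightarrow> 'm set"
    and J :: "'m \<Rightarrow> 'm" and X1 :: "'m \<Rightarrow> 'm" and A :: "'m \<Rightarrow> 'm \<Rightarrow> 'm"
  assumes CR: "fundamental_CR_algebra \<mu> br gr J"
    and X1_linear: "linear X1"
    and A_linear: "linear (\<lambda>Y. A Y Z)"
    and A_aut: "y \<in> gr 1 \<Longrightarrow> A y \<in> aut_CR br gr J"
    and A_low: "u \<in> gr j \<Longrightarrow> 2 \<le> j \<Longrightarrow> A u z = 0"
    and X1_gr1: "y \<in> gr 1 \<Longrightarrow> X1 y = 0"
    and X1_gr: "u \<in> gr (Suc (Suc j)) \<Longrightarrow> X1 u \<in> gr (Suc j)"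
    and X1_br: "X1 (br y z) = br (X1 y) z + br y (X1 z) + A y z - A z y"
begin

lemma fundamental: "fundamental_algebra \<mu> br gr"
  using CR by (simp add: fundamental_CR_algebra_def)

lemmas br_bilinear = fundamental_algebraD(1)[OF fundamental]
  and br_self = fundamental_algebraD(2)[OF fundamental]
  and br_jacobi = fundamental_algebraD(3)[OF fundamental]
  and gr_subspace = fundamental_algebraD(4)[OF fundamental]
  and gr_top = fundamental_algebraD(5)[OF fundamental]
  and gr_decomp = fundamental_algebraD(7)[OF fundamental]
  and br_gr = fundamental_algebraD(8)[OF fundamental]
  and gr_generated = fundamental_algebraD(9)[OF fundamental]

lemma J_complex: "complex_structure_on (gr 1) J"
  and J_br: "x \<in> gr 1 \<Longrightarrow> y \<in> gr 1 \<Longrightarrow> br (J x) (J y) = br x y"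
  using CR by (simp_all add: fundamental_CR_algebra_def)

lemma J_gr: "x \<in> gr 1 \<Longrightarrow> J x \<in> gr 1"
  and J_add: "x \<in> gr 1 \<Longrightarrow> y \<in> gr 1 \<Longrightarrow> J (x + y) = J x + J y"
  and J_scale: "x \<in> gr 1 \<Longrightarrow> J (r *\<^sub>R x) = r *\<^sub>R J x"
  and J_J: "x \<in> gr 1 \<Longrightarrow> J (J x) = - x"
  using J_complex by (simp_all add: complex_structure_on_def)

lemma br_simps:
  "br (x + y) z = br x z + br y z" "br z (x + y) = br z x + br z y"
  "br (x - y) z = br x z - br y z" "br z (x - y) = br z x - br z y"
  "br (- x) z = - br x z" "br z (- x) = - br z x"
  "br (r *\<^sub>R x) z = r *\<^sub>R br x z" "br z (r *\<^sub>R x) = r *\<^sub>R br z x"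
  using br_bilinear
  by (simp_all add: bilinear_ladd bilinear_radd bilinear_lsub bilinear_rsub bilinear_lneg
      bilinear_rneg bilinear_lmul bilinear_rmul)

lemma br_anti: "br y x = - br x y"
proof -
  have "0 = br (x + y) (x + y)" by (simp only: br_self)
  also have "\<dots> = br x y + br y x" unfolding br_simps(1,2) by (simp add: br_self)
  finally show ?thesis by (metis add.commute eq_neg_iff_add_eq_0)
qed

lemma br_derivation: "br x (br y z) = br (br x y) z + br y (br x z)"
proof -
  have zx: "br z x = - br x z" and zxy: "br z (br x y) = - br (br x y) z"
    by (rule br_anti)+
  have "br x (br y z) + br y (- br x z) + - br (br x y) z = 0"
    using br_jacobi[of x y z] unfolding zx zxy .
  then show ?thesis
    by (simp add: br_simps algebra_simps)
qed

lemma A_simps: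
  "A (x + y) z = A x z + A y z" "A (x - y) z = A x z - A y z" "A (- x) z = - A x z"
  "A (r *\<^sub>R x) z = r *\<^sub>R A x z"
  using A_linear[of z]
  by (simp_all add: linear_add[of "\<lambda>y. A y z"] linear_diff[of "\<lambda>y. A y z"]
      linear_neg[of "\<lambda>y. A y z"] linear_scale[of "\<lambda>y. A y z"])

lemma A_right_simps:
  assumes "y \<in> gr 1"
  shows "A y (u + v) = A y u + A y v" "A y (u - v) = A y u - A y v" "A y (- u) = - A y u"
    "A y (r *\<^sub>R u) = r *\<^sub>R A y u"
    "A y (br u v) = br (A y u) v + br u (A y v)" "u \<in> gr k \<Longrightarrow> A y u \<in> gr k"
    "u \<in> gr 1 \<Longrightarrow> A y (J u) = J (A y u)"
proof -
  have "A y \<in> aut_CR br gr J" by (rule A_aut[OF assms])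
  then have l: "linear (A y)" and "\<forall>u v. A y (br u v) = br (A y u) v + br u (A y v)"
    "\<forall>k. \<forall>u\<in>gr k. A y u \<in> gr k" "\<forall>u\<in>gr 1. A y (J u) = J (A y u)"
    unfolding aut_CR_def by blast+
  then show "A y (br u v) = br (A y u) v + br u (A y v)" "u \<in> gr k \<Longrightarrow> A y u \<in> gr k"
    "u \<in> gr 1 \<Longrightarrow> A y (J u) = J (A y u)" by blast+
  show "A y (u + v) = A y u + A y v" "A y (u - v) = A y u - A y v" "A y (- u) = - A y u"
    "A y (r *\<^sub>R u) = r *\<^sub>R A y u"
    by (fact linear_add[OF l] linear_diff[OF l] linear_neg[OF l] linear_scale[OF l])+
qed

lemma eigenspace_iff:
  "(x, y) \<in> eigenspace (gr 1) J \<i> \<longleftrightarrow> x \<in> gr 1 \<and> y = - J x"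
  "(x, y) \<in> eigenspace (gr 1) J (- \<i>) \<longleftrightarrow> x \<in> gr 1 \<and> y = J x"
proof -
  have neg: "J (- J x) = x \<and> - J x \<in> gr 1" if "x \<in> gr 1" for x
    using J_scale[OF J_gr[OF that], of "- 1"] J_J[OF that] J_gr[OF that] subspace_neg[OF gr_subspace]
    by auto
  show "(x, y) \<in> eigenspace (gr 1) J \<i> \<longleftrightarrow> x \<in> gr 1 \<and> y = - J x"
    using neg[of x] by (auto simp: eigenspace_def cscale_def)
  show "(x, y) \<in> eigenspace (gr 1) J (- \<i>) \<longleftrightarrow> x \<in> gr 1 \<and> y = J x"
    using J_J[of x] J_gr[of x] by (auto simp: eigenspace_def cscale_def)
qed

lemma complex_prolongation_complexify:
  assumes tn: "totally_nondegenerate \<mu> br gr J" and \<mu>: "\<mu> = n + 4"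
  shows "complex_prolongation cscale (complexify br) (\<lambda>k. gr k \<times> gr k)
    (eigenspace (gr 1) J (- \<i>)) (eigenspace (gr 1) J \<i>) (complexify A) (map_prod X1 X1) n"
proof -
  note X1_simps = linear_add[OF X1_linear] linear_diff[OF X1_linear] linear_scale[OF X1_linear]
  note gs = subspace_add[OF gr_subspace] subspace_diff[OF gr_subspace] subspace_scale[OF gr_subspace]
    subspace_neg[OF gr_subspace] subspace_0[OF gr_subspace]
  have tn': "totally_nondegenerate (Suc (Suc (n + 2))) br gr J"
    using tn \<mu> by (simp add: eval_nat_numeral)
  note fq = filiform_quotient[OF J_complex gr_subspace tn']
  interpret cs: complex_space cscale by (rule complex_space_cscale)
  have Jn: "J (- x) = - J x" if "x \<in> gr 1" for x
    using J_scale[OF that, of "- 1"] by simp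
  have Jd: "J (x - y) = J x - J y" if "x \<in> gr 1" "y \<in> gr 1" for x y
    using J_add[OF that(1), of "- y"] Jn that gs by simp
  note J_simps = J_add J_scale Jn Jd
  show ?thesis
  proof (unfold_locales, goal_cases)
    case (1 x y z) show ?case by (cases x; cases y; cases z) (simp add: complexify_def br_simps)
  next
    case (2 z x y) show ?case by (cases x; cases y; cases z) (simp add: complexify_def br_simps)
  next
    case (3 c x y) show ?case
      by (cases x; cases y) (simp add: complexify_def cscale_def br_simps scaleR_diff_right scaleR_add_right)
  next
    case (4 x c y) show ?case
      by (cases x; cases y) (simp add: complexify_def cscale_def br_simps scaleR_diff_right scaleR_add_right)
  next
    case (5 y x) show ?case
      using br_anti[of "fst x" "fst y"] br_anti[of "snd x" "fst y"] br_anti[of "fst x" "snd y"]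
        br_anti[of "snd x" "snd y"]
      by (cases x; cases y) (simp add: complexify_def)
  next
    case (6 x y z) show ?case
    proof -
      obtain a b where x: "x = (a, b)" by (cases x)
      show ?thesis
        by (cases y; cases z)
          (simp add: x complexify_def br_simps br_derivation[of a] br_derivation[of b])
    qed
  next
    case (7 x i y j) then show ?case
      by (auto simp: complexify_def intro!: gs br_gr)
  next
    case 8
    have "gr (n + 5) = {0}" by (rule gr_top) (simp add: \<mu>)
    then show ?case by (simp add: zero_prod_def)
  next
    case (9 w) then show ?case by (auto simp: eigenspace_def)
  next
    case (10 w) then show ?case by (auto simp: eigenspace_def)
  next
    case (11 w w') then show ?case
      by (cases w; cases w') (auto simp: eigenspace_iff J_simps intro!: gs simp del: One_nat_def)
  next
    case (12 w w') then show ?case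
      by (cases w; cases w') (auto simp: eigenspace_iff J_simps intro!: gs simp del: One_nat_def)
  next
    case (13 w c) then show ?case
      by (cases w) (auto simp: eigenspace_iff cscale_def J_simps J_gr J_J gs simp del: One_nat_def)
  next
    case (14 w c) then show ?case
      by (cases w) (auto simp: eigenspace_iff cscale_def J_simps J_gr J_J gs simp del: One_nat_def)
  next
    case (15 w w') 
    have "br x (J y) = - br (J x) y" if "x \<in> gr 1" "y \<in> gr 1" for x y
      using J_br[of x "J y"] that by (simp add: J_J J_gr br_simps del: One_nat_def)
    with 15 show ?case
      by (cases w; cases w') (auto simp: eigenspace_iff complexify_def J_br zero_prod_def simp del: One_nat_def)
  next
    case (16 w w')
    have "br x (J y) = - br (J x) y" if "x \<in> gr 1" "y \<in> gr 1" for x y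
      using J_br[of x "J y"] that by (simp add: J_J J_gr br_simps del: One_nat_def)
    with 16 show ?case
      by (cases w; cases w') (auto simp: eigenspace_iff complexify_def J_br br_simps zero_prod_def simp del: One_nat_def)
  next
    case (17 x y z) show ?case by (cases x; cases y; cases z) (simp add: complexify_def A_simps)
  next
    case (18 c x z) show ?case
      by (cases x; cases z) (simp add: complexify_def cscale_def A_simps scaleR_diff_right scaleR_add_right)
  next
    case (19 z x y) then show ?case
      by (cases x; cases y; cases z) (simp add: complexify_def A_right_simps del: One_nat_def)
  next
    case (20 z c x) then show ?case
      by (cases x; cases z) (simp add: complexify_def cscale_def A_right_simps
          scaleR_diff_right scaleR_add_right del: One_nat_def)
  next
    case (21 z x y) then show ?case
      by (cases x; cases y; cases z) (simp add: complexify_def A_right_simps br_simps del: One_nat_def)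
  next
    case (22 z u j) then show ?case
      by (cases u; cases z) (simp add: complexify_def A_right_simps gs del: One_nat_def)
  next
    case (23 z w) then show ?case
      by (cases w; cases z) (auto simp: eigenspace_iff complexify_def A_right_simps J_simps J_gr J_J gs simp del: One_nat_def)
  next
    case (24 z w) then show ?case
      by (cases w; cases z) (auto simp: eigenspace_iff complexify_def A_right_simps J_simps J_gr J_J gs simp del: One_nat_def)
  next
    case (25 u j x) then show ?case
      by (cases u; cases x) (simp add: complexify_def A_low[of _ j] zero_prod_def)
  next
    case (26 x y) show ?case by (cases x; cases y) (simp add: X1_simps)
  next
    case (27 c x) show ?case by (cases x) (simp add: cscale_def X1_simps)
  next
    case (28 u) then show ?case by (cases u) (simp add: X1_gr1 zero_prod_def)
  next
    case (29 u j) then show ?case by (cases u) (simp add: X1_gr)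
  next
    case (30 y z) show ?case by (cases y; cases z) (simp add: complexify_def X1_simps X1_br)
  next
    case (31 \<alpha> \<eta>) then show ?case using fq[of "- \<i>" \<alpha> \<eta>] by simp
  next
    case (32 \<alpha> \<eta>) then show ?case using fq[of \<i> \<alpha> \<eta>] by simp
  qed
qed

text \<open>
  Every \<open>y \<in> \<mm>\<^sup>-\<^sup>1\<close> is half the sum of \<open>y + \<i> J y\<close> and \<open>y - \<i> J y\<close>, which belong to the two eigenspaces
  and are nonzero for \<open>y \<noteq> 0\<close>; so the real statement follows from the one for the complexification.
\<close>

lemma A_vanishes_on_gr1:
  assumes tn: "totally_nondegenerate \<mu> br gr J" and "\<mu> > 3" and "y \<in> gr 1" "z \<in> gr 1"
  shows "A y z = 0"
proof (cases "y = 0")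
  case True then show ?thesis using A_simps(4)[of 0 y z] by simp
next
  case False
  obtain n where n: "\<mu> = n + 4"
    using assms(2) by (metis add.commute less_eq_Suc_le le_Suc_ex numeral_3_eq_3 eval_nat_numeral(2) Suc_numeral semiring_norm(2) semiring_norm(8))
  interpret complex_prolongation cscale "complexify br" "\<lambda>k. gr k \<times> gr k"
    "eigenspace (gr 1) J (- \<i>)" "eigenspace (gr 1) J \<i>" "complexify A" "map_prod X1 X1" n
    by (rule complex_prolongation_complexify[OF tn n])
  let ?E = "eigenspace (gr 1) J (- \<i>) \<union> eigenspace (gr 1) J \<i>"
  have mem: "(x, J x) \<in> ?E" "(x, - J x) \<in> ?E" if "x \<in> gr 1" for x
    using that by (simp_all add: eigenspace_iff del: One_nat_def)
  have vanish: "complexify A u v = 0" if "u \<in> ?E" "v \<in> ?E" for u v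
    using P_vanishes[OF _ _ _ _ that, of "(y, J y)" "(y, - J y)"] assms(3) False
    by (simp add: eigenspace_iff zero_prod_def del: One_nat_def)
  have "complexify A (y, J y) (z, J z) = 0" "complexify A (y, - J y) (z, J z) = 0"
    by (intro vanish mem assms)+
  then have "A y z - A (J y) (J z) = 0" "A y z + A (J y) (J z) = 0"
    by (simp_all add: complexify_def zero_prod_def A_simps)
  then have "A y z + A y z = 0" by simp
  then show ?thesis using scaleR_2[of "A y z"] by simp
qed

text \<open>
  The algebra is generated in degree \<open>-1\<close>.
\<close>

lemma derivation_vanishes:
  assumes lin: "linear D" and der: "\<And>x y. D (br x y) = br (D x) y + br x (D y)"
    and gr1: "\<And>x. x \<in> gr 1 \<Longrightarrow> D x = 0"
  shows "D x = 0"
proof -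
  have "\<forall>x\<in>gr (Suc k). D x = 0" for k
  proof (induction k)
    case 0 then show ?case using gr1 by simp
  next
    case (Suc k)
    have "D x = 0" if "x \<in> span {br x y | x y. x \<in> gr (Suc k) \<and> y \<in> gr 1}" for x
      using lin _ that
    proof (rule linear_eq_0_on_span)
      fix b assume "b \<in> {br x y | x y. x \<in> gr (Suc k) \<and> y \<in> gr 1}"
      then obtain x y where "b = br x y" "x \<in> gr (Suc k)" "y \<in> gr 1" by blast
      then show "D b = 0"
        using Suc.IH gr1[of y] br_simps(7)[of 0 x y] br_simps(8)[of x 0 y] by (simp add: der)
    qed
    then show ?case using gr_generated[of "Suc k"] by simp
  qed
  then have g: "D x = 0" if "x \<in> gr k" "k \<ge> 1" for x k
    using that by (cases k) auto
  obtain f where f: "\<forall>k. f k \<in> gr k" "x = (\<Sum>k=1..\<mu>. f k)" using gr_decomp by blast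
  have "D (f k) = 0" if "k \<in> {1..\<mu>}" for k
    using g[of "f k" k] f(1) that by simp
  then show ?thesis
    unfolding f(2) linear_sum[OF lin] by (intro sum.neutral) blast
qed

lemma vanishing:
  assumes tn: "totally_nondegenerate \<mu> br gr J" and \<mu>: "\<mu> > 3"
  shows "A y z = 0" and "X1 y = 0"
proof -
  have A1: "A y z = 0" if "y \<in> gr 1" for y z
  proof (rule derivation_vanishes[of "A y"])
    show "linear (A y)" "A y (br u v) = br (A y u) v + br u (A y v)" for u v
      using A_aut[OF that] unfolding aut_CR_def by blast+
    show "A y u = 0" if "u \<in> gr 1" for u
      by (rule A_vanishes_on_gr1[OF tn \<mu> \<open>y \<in> gr 1\<close> that])
  qed
  have A0: "A y z = 0" for y z
  proof -
    obtain f where f: "\<forall>k. f k \<in> gr k" "y = (\<Sum>k=1..\<mu>. f k)" using gr_decomp by blast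
    have "A (f k) z = 0" if "k \<ge> 1" for k
      using A1[of "f 1"] A_low[of "f k" k] f(1) that by (cases "k = 1") auto
    then show ?thesis
      by (auto simp: f(2) linear_sum[OF A_linear] intro!: sum.neutral)
  qed
  then show "A y z = 0" .
  show "X1 y = 0"
    by (rule derivation_vanishes[OF X1_linear]) (simp_all add: X1_br A0 X1_gr1)
qed

end

text \<open>
  The encoding by functions on lists: \<open>X [Y]\<close> is the component in \<open>\<mm>\<close> of the value of \<open>X\<close> at \<open>Y\<close>, and
  \<open>X [Y, Z]\<close> is the action on \<open>Z\<close> of its component in \<open>\<gg>\<^sup>0\<close>. Longer lists would belong to components in
  \<open>\<gg>\<^sup>1\<close> and higher, which do not occur in degree one.
\<close>

lemma prolongation_1_components:
  assumes CR: "fundamental_CR_algebra \<mu> br gr J" and X: "X \<in> prolongation \<mu> br gr J 1"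
  shows "degree_one_prolongation \<mu> br gr J (\<lambda>Y. X [Y]) (\<lambda>Y Z. X [Y, Z])"
    and "X [] = 0" and "X (Y # Z # Z' # ys) = 0"
proof -
  have fa: "fundamental_algebra \<mu> br gr"
    using CR by (simp add: fundamental_CR_algebra_def)
  note sub = fundamental_algebraD(4)[OF fa] and top = fundamental_algebraD(5)[OF fa]
    and pos = fundamental_algebraD(6)[OF fa] and decomp = fundamental_algebraD(7)[OF fa]
    and lie = fundamental_algebraD(1,2)[OF fa]
  have X0: "X [] = 0" and lin: "linear (\<lambda>Y. X (Y # ys))"
    and comp: "p \<in> {1..\<mu>} \<Longrightarrow> Y \<in> gr p \<Longrightarrow> pr_apply X Y \<in> prolongation \<mu> br gr J (1 - int p)"
    and cocycle: "pr_bracket br (pr_apply X Y) Z ys - pr_bracket br (pr_apply X Z) Y ys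
                         = pr_apply X (br Y Z) ys" for ys p Y Z
    using X unfolding prolongation.simps[of \<mu> br gr J 1] by (auto simp: pr_apply_def)
  show "X [] = 0" by (rule X0)
  have deg1: "\<exists>D\<in>aut_CR br gr J. pr_apply X Y = pr_of_hom (\<lambda>Y. pr_of_m (D Y))" if "Y \<in> gr 1" for Y
    using comp[of 1 Y] that pos by (auto simp: prolongation.simps[of \<mu> br gr J 0])
  have low: "\<exists>y\<in>gr (p - 1). pr_apply X Y = pr_of_m y" if "Y \<in> gr p" "2 \<le> p" for Y p
  proof (cases "p \<le> \<mu>")
    case True
    have "nat (int p - 1) = p - 1" by simp
    then show ?thesis
      using comp[of p Y] that True by (auto simp: prolongation.simps[of \<mu> br gr J "1 - int p"])
  next
    case False
    then have "Y = 0" using top[of p] that by auto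
    then have "pr_apply X Y = pr_of_m 0"
      using linear_0[OF lin] by (auto simp: pr_apply_def pr_of_m_def)
    then show ?thesis using subspace_0[OF sub] by blast
  qed
  have low': "X [Y] \<in> gr (p - 1)" "X (Y # Z # ys) = 0" if YP: "Y \<in> gr p" "2 \<le> p" for Y Z p ys
  proof -
    obtain y where y: "y \<in> gr (p - 1)" "pr_apply X Y = pr_of_m y" using low[OF YP] by blast
    then have *: "X (Y # zs) = pr_of_m y zs" for zs by (metis pr_apply_def)
    show "X [Y] \<in> gr (p - 1)" "X (Y # Z # ys) = 0" using y(1) by (simp_all add: * pr_of_m_def)
  qed
  have deg1': "X [Y] = 0" "(\<lambda>Z. X [Y, Z]) \<in> aut_CR br gr J" "X (Y # Z # Z' # ys) = 0"
    if Y: "Y \<in> gr 1" for Y Z Z' ys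
  proof -
    obtain D where D: "D \<in> aut_CR br gr J" "pr_apply X Y = pr_of_hom (\<lambda>Y. pr_of_m (D Y))"
      using deg1[OF Y] by blast
    then have *: "X (Y # zs) = pr_of_hom (\<lambda>Y. pr_of_m (D Y)) zs" for zs by (metis pr_apply_def)
    show "X [Y] = 0" "(\<lambda>Z. X [Y, Z]) \<in> aut_CR br gr J" "X (Y # Z # Z' # ys) = 0"
      using D(1) by (simp_all add: * pr_of_m_def pr_of_hom_def)
  qed
  show "X (Y # Z # Z' # ys) = 0"
  proof -
    obtain f where f: "\<forall>k. f k \<in> gr k" "Y = (\<Sum>k=1..\<mu>. f k)" using decomp by blast
    have "X (f k # Z # Z' # ys) = 0" if "k \<ge> 1" for k
      using deg1'(3)[of "f 1"] low'(2)[of "f k" k] f(1) that by (cases "k = 1") auto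
    then show ?thesis
      by (auto simp: f(2) linear_sum[OF lin] intro!: sum.neutral)
  qed
  show "degree_one_prolongation \<mu> br gr J (\<lambda>Y. X [Y]) (\<lambda>Y Z. X [Y, Z])"
  proof (rule degree_one_prolongation.intro, goal_cases)
    case 1 show ?case by (rule CR)
  next
    case 2 show ?case by (rule lin)
  next
    case 3 show ?case by (rule lin)
  next
    case 4 then show ?case by (rule deg1')
  next
    case 5 then show ?case by (rule low')
  next
    case 6 then show ?case by (rule deg1')
  next
    case (7 u j) then show ?case using low'(1)[of u "Suc (Suc j)"] by simp
  next
    case (8 y z)
    have anti: "br x y = - br y x" for x y
    proof -
      have "br (x + y) (x + y) = br x y + br y x"
        unfolding bilinear_ladd[OF lie(1)] bilinear_radd[OF lie(1)] by (simp add: lie(2))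
      then show ?thesis by (simp add: lie(2) eq_neg_iff_add_eq_0)
    qed
    show ?case
      using cocycle[of y z "[]"] anti[of y "X [z]"]
      by (simp add: pr_bracket_def pr_of_m_def pr_apply_def algebra_simps)
  qed
qed

lemma prolongation_1_trivial:
  assumes CR: "fundamental_CR_algebra \<mu> br gr J" and tn: "totally_nondegenerate \<mu> br gr J"
    and \<mu>: "\<mu> > 3"
  shows "prolongation \<mu> br gr J 1 = {pr_zero}"
proof (intro equalityI subsetI)
  fix X assume X: "X \<in> prolongation \<mu> br gr J 1"
  interpret degree_one_prolongation \<mu> br gr J "\<lambda>Y. X [Y]" "\<lambda>Y Z. X [Y, Z]"
    by (rule prolongation_1_components[OF CR X])
  have "X ys = 0" for ys
  proof -
    consider "ys = []" | Y where "ys = [Y]" | Y Z where "ys = [Y, Z]"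
      | Y Z Z' zs where "ys = Y # Z # Z' # zs"
      by (metis list.exhaust)
    then show ?thesis
      by cases (use prolongation_1_components(2,3)[OF CR X] vanishing[OF tn \<mu>] in simp_all)
  qed
  then show "X \<in> {pr_zero}" by (auto simp: pr_zero_def)
next
  have fa: "fundamental_algebra \<mu> br gr"
    using CR by (simp add: fundamental_CR_algebra_def)
  have J: "complex_structure_on (gr 1) J"
    using CR by (simp add: fundamental_CR_algebra_def)
  have g0: "0 \<in> gr k" for k
    by (rule subspace_0[OF fundamental_algebraD(4)[OF fa]])
  have "J 0 = 0"
    using J g0[of 1] unfolding complex_structure_on_def by (metis scaleR_zero_left)
  then have "(\<lambda>_. 0) \<in> aut_CR br gr J"
    using g0 bilinear_lzero[OF fundamental_algebraD(1)[OF fa]] bilinear_rzero[OF fundamental_algebraD(1)[OF fa]]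
    by (auto simp: aut_CR_def linear_0 intro!: linearI)
  moreover have "pr_of_hom (\<lambda>_. pr_of_m 0) = (pr_zero :: 'a pr)"
    by (auto simp: pr_of_hom_def pr_of_m_def pr_zero_def fun_eq_iff split: list.splits)
  ultimately have "pr_zero \<in> prolongation \<mu> br gr J 0"
    unfolding prolongation.simps[of \<mu> br gr J 0] by (auto intro!: exI[of _ "\<lambda>_. 0"])
  moreover have "pr_zero \<in> prolongation \<mu> br gr J i" if "i < 0" for i
    using that g0 by (auto simp: prolongation.simps[of \<mu> br gr J i] pr_of_m_def pr_zero_def intro!: image_eqI[of _ _ 0])
  ultimately have le: "pr_zero \<in> prolongation \<mu> br gr J i" if "i \<le> 0" for i
    using that by (cases "i = 0") auto
  fix X assume "X \<in> {pr_zero :: 'a pr}"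
  then show "X \<in> prolongation \<mu> br gr J 1"
    unfolding prolongation.simps[of \<mu> br gr J 1]
    using le bilinear_lzero[OF fundamental_algebraD(1)[OF fa]]
    by (auto simp: pr_zero_def pr_apply_def pr_bracket_def pr_of_m_def linear_zero)
qed

theorem theorem3p5:
  fixes \<mu> :: nat
    and br :: "'m::real_vector \<Rightarrow> 'm \<Rightarrow> 'm"
    and gr :: "nat \<Rightarrow> 'm set"
    and J :: "'m \<Rightarrow> 'm"
  assumes "fundamental_CR_algebra \<mu> br gr J"
    and "totally_nondegenerate \<mu> br gr J"
    and "\<mu> > 3"
  shows "prolongation \<mu> br gr J 1 = {pr_zero} \<and>
    (\<forall>(A :: ('p::{t2_space,second_countable_topology}, 'e::euclidean_space) chart set) D JM.
       CR_manifold A D JM \<and> regular_of_type A D JM br gr J \<longrightarrow>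
       finite_order \<mu> br gr J \<and> geometry_order \<mu> br gr J = 0)"
proof -
  have 1: "prolongation \<mu> br gr J (int 0 + 1) = {pr_zero}"
    using prolongation_1_trivial[OF assms] by simp
  then have "finite_order \<mu> br gr J"
    unfolding finite_order_def by blast
  moreover have "geometry_order \<mu> br gr J = 0"
    unfolding geometry_order_def by (rule Least_eq_0) (rule 1)
  ultimately show ?thesis using 1 by simp
qed

end
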